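(* For each $n$ let $m=m(n)$ be an integer with $1\le m\le n/2$, let $G=K_{m,n-m}$ be the complete bipartite graph with parts of sizes $m$ and $n-m$, with vertex set $V$, $|V|=n$, and let $(\eta_t)_{t\ge0}$ be the averaging process on $G$. Let $\pi\equiv1/n$ be the uniform distribution on $V$ and let $$T(a):=\frac{\log n}{\theta m}+\frac{a}{\theta m},\qquad a\in\mathbb{R},$$ where $$\theta=\theta_{m,n-m}:=\frac{3n}{8m}\left(1-\sqrt{1-\frac{32}{9}\,\frac mn\left(\frac{n-m}{n}\right)}\right)\in\left[\tfrac12,\tfrac23\right].$$ Assume that $m/n\to b\in[0,1/2]$ as $n\to\infty$. Then $$\lim_{n\to\infty}\sup_{\xi\in\Delta(V)}\mathbb{E}_\xi\left[\left\|\frac{\eta_{T(a)}}{\pi}-1\right\|_2^2\right]=(1+D(b))\,e^{-a},\qquad a\in\mathbb{R},$$ where $$D(b):=\frac{3-4b-\sqrt{9-32b+32b^2}}{2\sqrt{9-32b+32b^2}}\in\left[0,\tfrac{\sqrt6-2}{4}\right],\qquad b\in[0,1/2].$$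
   Context: For a finite connected graph $G=(V,E)$, let $\Delta(V)$ be the set of probability mass functions on $V$. The averaging process on $G$ is the continuous-time Markov process $(\eta_t)_{t\ge0}$ on $\Delta(V)$ in which each edge $xy\in E$ carries an independent Poisson clock of rate $1$; when the clock of $xy$ rings, both $\eta(x)$ and $\eta(y)$ are replaced by $\frac12(\eta(x)+\eta(y))$, the other values being unchanged. $\mathbb{E}_\xi$ is the expectation when $\eta_0=\xi\in\Delta(V)$. For $f:V\to\mathbb{R}$, $\|f\|_2=\big(\sum_{x\in V}\pi(x)f(x)^2\big)^{1/2}$ is the $L^2(\pi)$-norm, and $\eta/\pi$ denotes the function $x\mapsto\eta(x)/\pi(x)=n\,\eta(x)$. For fixed $a$, $T(a)\geq0$ for all $n$ large enough. $\log$ is the natural logarithm. *)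

theory Defs
  imports "HOL-Probability.Probability"
begin

section \<open>Poisson clocks\<close>

text \<open>
  Natural-number subtraction in the increments is harmless: the paths are almost surely
  nondecreasing.
\<close>

definition poisson_process :: "'w measure \<Rightarrow> real \<Rightarrow> (real \<Rightarrow> 'w \<Rightarrow> nat) \<Rightarrow> bool" where
  "poisson_process M r N \<longleftrightarrow>
     (\<forall>t\<ge>0. N t \<in> measurable M (count_space UNIV)) \<and>
     (AE \<omega> in M. N 0 \<omega> = 0 \<and>
        (\<forall>s t. 0 \<le> s \<and> s \<le> t \<longrightarrow> N s \<omega> \<le> N t \<omega>) \<and>
        (\<forall>t\<ge>0. continuous (at_right t) (\<lambda>s. N s \<omega>))) \<and>
     (\<forall>s t. 0 \<le> s \<and> s < t \<longrightarrow>
        distr M (count_space UNIV) (\<lambda>\<omega>. N t \<omega> - N s \<omega>) = measure_pmf (poisson_pmf (r * (t - s)))) \<and>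
     (\<forall>(\<tau> :: nat \<Rightarrow> real) k. 0 \<le> \<tau> 0 \<and> mono \<tau> \<longrightarrow>
        prob_space.indep_vars M (\<lambda>_. count_space UNIV)
          (\<lambda>i \<omega>. N (\<tau> (Suc i)) \<omega> - N (\<tau> i) \<omega>) {..<k})"

text \<open>Independence of the clocks is independence of the whole paths, as random elements of the
  product space over all times in \<open>{0..}\<close>.\<close>

definition independent_poisson_clocks ::
    "'w measure \<Rightarrow> real \<Rightarrow> 'e set \<Rightarrow> ('e \<Rightarrow> real \<Rightarrow> 'w \<Rightarrow> nat) \<Rightarrow> bool" where
  "independent_poisson_clocks M r E N \<longleftrightarrow>
     (\<forall>e\<in>E. poisson_process M r (N e)) \<and>
     prob_space.indep_vars M (\<lambda>_. \<Pi>\<^sub>M t\<in>{0..}. count_space UNIV)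
       (\<lambda>e \<omega>. \<lambda>t\<in>{0..}. N e t \<omega>) E"

text \<open>The clock rings when its counting path jumps; for a nondecreasing integer-valued path
  \<open>c\<close> the left limit at \<open>t > 0\<close> is smaller than \<open>c t\<close> iff all earlier values are.\<close>

definition ring_times :: "(real \<Rightarrow> nat) \<Rightarrow> real set" where
  "ring_times c = {t. 0 < t \<and> (\<forall>s. 0 \<le> s \<and> s < t \<longrightarrow> c s < c t)}"

section \<open>The averaging process\<close>

text \<open>Mass functions on \<open>V\<close> are extended by \<open>0\<close> outside \<open>V\<close>.\<close>

definition prob_mass_functions :: "'v set \<Rightarrow> ('v \<Rightarrow> real) set" where
  "prob_mass_functions V =
     {\<xi>. (\<forall>x\<in>V. 0 \<le> \<xi> x) \<and> (\<forall>x. x \<notin> V \<longrightarrow> \<xi> x = 0) \<and> (\<Sum>x\<in>V. \<xi> x) = 1}"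

definition edge_average :: "'v \<Rightarrow> 'v \<Rightarrow> ('v \<Rightarrow> real) \<Rightarrow> 'v \<Rightarrow> real" where
  "edge_average x y \<eta> = \<eta>(x := (\<eta> x + \<eta> y) / 2, y := (\<eta> x + \<eta> y) / 2)"

text \<open>
  A path \<open>p\<close> is driven by the counting paths \<open>c e\<close> if it is constant as long as no clock rings,
  and a ring of the clock of \<open>xy\<close> at time \<open>t\<close> averages the state just before \<open>t\<close>, i.e. the
  state at any earlier time \<open>s\<close> such that no clock rings strictly between \<open>s\<close> and \<open>t\<close>.
  (Two clocks almost surely never ring simultaneously.)
\<close>

definition averaging_path ::
    "'v set set \<Rightarrow> ('v set \<Rightarrow> real \<Rightarrow> nat) \<Rightarrow> (real \<Rightarrow> 'v \<Rightarrow> real) \<Rightarrow> bool" where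
  "averaging_path E c p \<longleftrightarrow>
     (\<forall>s t. 0 \<le> s \<and> s \<le> t \<and> (\<forall>e\<in>E. ring_times (c e) \<inter> {s<..t} = {}) \<longrightarrow> p t = p s) \<and>
     (\<forall>x y t s. {x, y} \<in> E \<and> t \<in> ring_times (c {x, y}) \<and> 0 \<le> s \<and> s < t \<and>
        (\<forall>e\<in>E. ring_times (c e) \<inter> {s<..<t} = {}) \<longrightarrow> p t = edge_average x y (p s))"

text \<open>\<open>\<eta>\<close> is a realisation, on the probability space \<open>M\<close>, of the averaging process on the graph
  \<open>(V, E)\<close> started at \<open>\<xi>\<close>; edges are two-element vertex sets. The expectation
  \<open>\<bbbE>\<^sub>\<xi>\<close> is the expectation with respect to \<open>M\<close>.\<close>

definition averaging_process ::
    "'w measure \<Rightarrow> 'v set \<Rightarrow> 'v set set \<Rightarrow> ('v \<Rightarrow> real) \<Rightarrow> (real \<Rightarrow> 'w \<Rightarrow> 'v \<Rightarrow> real) \<Rightarrow> bool" where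
  "averaging_process M V E \<xi> \<eta> \<longleftrightarrow>
     prob_space M \<and> \<xi> \<in> prob_mass_functions V \<and>
     (\<forall>t\<ge>0. \<forall>x\<in>V. (\<lambda>\<omega>. \<eta> t \<omega> x) \<in> borel_measurable M) \<and>
     (\<exists>N. independent_poisson_clocks M 1 E N \<and>
        (AE \<omega> in M. \<eta> 0 \<omega> = \<xi> \<and> averaging_path E (\<lambda>e t. N e t \<omega>) (\<lambda>t. \<eta> t \<omega>)))"

definition uniform_mass :: "'v set \<Rightarrow> 'v \<Rightarrow> real" where
  "uniform_mass V x = 1 / real (card V)"

definition L2_norm :: "'v set \<Rightarrow> ('v \<Rightarrow> real) \<Rightarrow> ('v \<Rightarrow> real) \<Rightarrow> real" where
  "L2_norm V \<pi> f = sqrt (\<Sum>x\<in>V. \<pi> x * (f x)\<^sup>2)"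

section \<open>Complete bipartite graphs and the constants\<close>

definition bipartite_vertices :: "nat \<Rightarrow> nat \<Rightarrow> nat set" where
  "bipartite_vertices k l = {..<k + l}"

definition bipartite_edges :: "nat \<Rightarrow> nat \<Rightarrow> nat set set" where
  "bipartite_edges k l = {{x, y} |x y. x \<in> {..<k} \<and> y \<in> {k..<k + l}}"

definition theta :: "nat \<Rightarrow> nat \<Rightarrow> real" where
  "theta k l = (let m = real k; n = real (k + l) in
     3 * n / (8 * m) * (1 - sqrt (1 - 32 / 9 * (m / n) * ((n - m) / n))))"

definition mixing_time :: "nat \<Rightarrow> nat \<Rightarrow> real \<Rightarrow> real" where
  "mixing_time k l a =
     ln (real (k + l)) / (theta k l * real k) + a / (theta k l * real k)"

definition D_const :: "real \<Rightarrow> real" where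
  "D_const b = (3 - 4 * b - sqrt (9 - 32 * b + 32 * b\<^sup>2)) / (2 * sqrt (9 - 32 * b + 32 * b\<^sup>2))"

end

theory Submission
  imports Defs "HOL-Real_Asymp.Real_Asymp"
begin

text \<open>
  Write \<open>n = k + l\<close> and let \<open>X\<close>, \<open>Y\<close> be the sums of \<open>(\<eta>(x) - 1/n)\<^sup>2\<close> over the two parts, so that the
  squared distance is \<open>n (X + Y)\<close>, and let \<open>Z\<close> be the square of the sum of \<open>\<eta>(x) - 1/n\<close> over the first
  part. The generator maps \<open>X\<close>, \<open>Y\<close> and \<open>Z\<close> to linear combinations of each other, so their expectations
  solve a linear system. Without \<open>Z\<close> its rates are \<open>\<theta> k\<close> and \<open>3 n / 4 - \<theta> k\<close>; the influence
  of \<open>Z\<close> is of relative order \<open>ln n / n\<close> at the mixing time. Expanding \<open>X + Y\<close> in the two left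
  eigenvectors gives \<open>1 + D(k/n)\<close> as the largest coefficient of the slow mode. It is approached
  when \<open>\<xi>\<close> is a point mass in the larger part.

  The linear system is used in a discretised form: \<open>[0, t]\<close> is cut into \<open>K\<close> steps, and the process is
  compared with a chain in which an edge acts in a step if it is the only one to ring. The two
  agree at time \<open>t\<close> unless two rings fall into the same step, which has probability \<open>O(1/K)\<close>.
\<close>

section \<open>Time discretisation\<close>

text \<open>On a grid, independence of the increments gives exact one-step recursions for
  expectations, and these are solved by elementary estimates. The order of limits matters: the grid
  is refined for a fixed graph and a fixed time, and only the explicit bounds that survive are taken
  to large \<open>n\<close>. The obstacle is \<open>Z\<close>. It lowers both modes, so the upper
  bound simply discards it, whereas the lower bound must show that the slow mode loses little to it
  over a time that grows like \<open>ln n\<close> divided by the slow rate. This needs a corrected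
  slow mode rather than a direct estimate.\<close>

lemma (in prob_space) indep_vars_nested:
  assumes indep: "indep_vars P X I" and fin: "finite I" "finite J"
    and g: "\<And>i j. i \<in> I \<Longrightarrow> j \<in> J \<Longrightarrow> g i j \<in> measurable (P i) (Q i j)"
    and indep_comp: "\<And>i. i \<in> I \<Longrightarrow> indep_vars (Q i) (\<lambda>j \<omega>. g i j (X i \<omega>)) J"
  shows "indep_vars (\<lambda>ij. Q (fst ij) (snd ij)) (\<lambda>ij \<omega>. g (fst ij) (snd ij) (X (fst ij) \<omega>)) (I \<times> J)"
proof (cases "I \<times> J = {}")
  case True
  then show ?thesis by (simp only: indep_vars_def indep_sets_def) auto
next
  case False
  then have ne: "I \<noteq> {}" "J \<noteq> {}" by auto
  define Y where "Y ij = (\<lambda>\<omega>. g (fst ij) (snd ij) (X (fst ij) \<omega>))" for ij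
  have X: "X i \<in> measurable M (P i)" if "i \<in> I" for i
    using indep that by (auto simp: indep_vars_def)
  have Y: "Y ij \<in> measurable M (Q (fst ij) (snd ij))" if "ij \<in> I \<times> J" for ij
    unfolding Y_def using that by (intro measurable_compose[OF X g]) auto
  have "prob (\<Inter>ij\<in>I \<times> J. Y ij -` A ij \<inter> space M) = (\<Prod>ij\<in>I \<times> J. prob (Y ij -` A ij \<inter> space M))"
    if A: "A \<in> (\<Pi> ij\<in>I \<times> J. sets (Q (fst ij) (snd ij)))" for A
  proof -
    have A': "A (i, j) \<in> sets (Q i j)" if "i \<in> I" "j \<in> J" for i j
      using A that by force
    \<comment> \<open>For fixed \<open>i\<close> the conditions for all \<open>j\<close> form a
      single event for \<open>X i\<close>. Independence over \<open>i\<close> factors these events,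
      and \<open>indep_comp\<close> then factors each of them over \<open>j\<close>.\<close>
    define B where "B i = (\<Inter>j\<in>J. g i j -` A (i, j) \<inter> space (P i))" for i
    have B: "B i \<in> sets (P i)" if "i \<in> I" for i
      unfolding B_def using that fin ne A' g by (intro sets.finite_INT) (auto intro: measurable_sets)
    have BX: "X i -` B i \<inter> space M = (\<Inter>j\<in>J. Y (i, j) -` A (i, j) \<inter> space M)" if "i \<in> I" for i
      using measurable_space[OF X[OF that]] ne by (auto simp: B_def Y_def)
    have "(\<Inter>ij\<in>I \<times> J. Y ij -` A ij \<inter> space M) = (\<Inter>i\<in>I. \<Inter>j\<in>J. Y (i, j) -` A (i, j) \<inter> space M)"
      by blast
    also have "\<dots> = (\<Inter>i\<in>I. X i -` B i \<inter> space M)"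
      by (rule INF_cong[OF refl]) (simp only: BX)
    also have "prob \<dots> = (\<Prod>i\<in>I. prob (X i -` B i \<inter> space M))"
      by (rule indep_varsD[OF indep]) (use ne fin B in auto)
    also have "\<dots> = (\<Prod>i\<in>I. \<Prod>j\<in>J. prob (Y (i, j) -` A (i, j) \<inter> space M))"
    proof (rule prod.cong[OF refl])
      fix i assume i: "i \<in> I"
      have "prob (\<Inter>j\<in>J. (\<lambda>\<omega>. g i j (X i \<omega>)) -` A (i, j) \<inter> space M)
          = (\<Prod>j\<in>J. prob ((\<lambda>\<omega>. g i j (X i \<omega>)) -` A (i, j) \<inter> space M))"
        by (rule indep_varsD[OF indep_comp[OF i]]) (use ne fin A' i in auto)
      then show "prob (X i -` B i \<inter> space M) = (\<Prod>j\<in>J. prob (Y (i, j) -` A (i, j) \<inter> space M))"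
        unfolding BX[OF i] by (simp add: Y_def)
    qed
    also have "\<dots> = (\<Prod>ij\<in>I \<times> J. prob (Y ij -` A ij \<inter> space M))"
      by (simp add: prod.cartesian_product case_prod_unfold)
    finally show ?thesis .
  qed
  then have prod: "\<forall>A\<in>(\<Pi> ij\<in>I \<times> J. sets (Q (fst ij) (snd ij))).
      prob (\<Inter>ij\<in>I \<times> J. Y ij -` A ij \<inter> space M) = (\<Prod>ij\<in>I \<times> J. prob (Y ij -` A ij \<inter> space M))"
    by blast
  have "indep_vars (\<lambda>ij. Q (fst ij) (snd ij)) Y (I \<times> J)"
    by (rule indep_vars_finite[where E="\<lambda>ij. sets (Q (fst ij) (snd ij))", THEN iffD2, OF _ _ _ _ _ _ _ prod])
      (use False fin Y in \<open>simp_all only: sets.sigma_sets_eq sets.Int_stable finite_cartesian_product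
        sets.top sets.space_closed simp_thms\<close>)
  then show ?thesis by (simp add: Y_def[abs_def])
qed

text \<open>
  In the time-discretised dynamics an edge acts only if it is the only one whose clock rings during
  the time step. With this rule the one-step expectation of an observable \<open>q\<close> is exactly
  \<open>q + \<rho> L q\<close>, where \<open>L\<close> is the generator and \<open>\<rho>\<close> the probability that a given edge is the only
  one to ring.
\<close>

definition sole_ring :: "'e set \<Rightarrow> ('e \<Rightarrow> nat) \<Rightarrow> 'e \<Rightarrow> bool" where
  "sole_ring E u e \<longleftrightarrow> e \<in> E \<and> 0 < u e \<and> (\<forall>e'\<in>E - {e}. u e' = 0)"

definition grid_step :: "('e \<Rightarrow> 's \<Rightarrow> 's) \<Rightarrow> 'e set \<Rightarrow> ('e \<Rightarrow> nat) \<Rightarrow> 's \<Rightarrow> 's" where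
  "grid_step f E u s = (if \<exists>e. sole_ring E u e then f (THE e. sole_ring E u e) s else s)"

text \<open>The increments are indexed by pairs (edge, step) so that they form one independent
  family.\<close>

primrec grid_chain :: "('e \<Rightarrow> 's \<Rightarrow> 's) \<Rightarrow> 'e set \<Rightarrow> ('e \<times> nat \<Rightarrow> nat) \<Rightarrow> 's \<Rightarrow> nat \<Rightarrow> 's" where
  "grid_chain f E d s 0 = s"
| "grid_chain f E d s (Suc k) = grid_step f E (\<lambda>e. d (e, k)) (grid_chain f E d s k)"

lemma sole_ring_unique: "sole_ring E u e \<Longrightarrow> sole_ring E u e' \<Longrightarrow> e = e'"
  unfolding sole_ring_def by (metis Diff_iff less_numeral_extra(3) singletonD)

lemma sole_ring_cong: "(\<And>e. e \<in> E \<Longrightarrow> u e = u' e) \<Longrightarrow> sole_ring E u e = sole_ring E u' e"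
  unfolding sole_ring_def by auto

lemma grid_step_sole_ring: "sole_ring E u e \<Longrightarrow> grid_step f E u s = f e s"
  unfolding grid_step_def using sole_ring_unique by (metis the_equality)

text \<open>Exhibits the state as a function of the finite family of past increments; its
  measurability and its independence of the next step both rest on this.\<close>

lemma grid_chain_restrict:
  "E \<times> {..<k} \<subseteq> B \<Longrightarrow> grid_chain f E (restrict d B) s k = grid_chain f E d s k"
proof (induction k)
  case (Suc k)
  have "sole_ring E (\<lambda>e. restrict d B (e, k)) = sole_ring E (\<lambda>e. d (e, k))"
    using Suc.prems by (intro ext sole_ring_cong) auto
  moreover have "E \<times> {..<k} \<subseteq> B" using Suc.prems by auto
  ultimately show ?case using Suc.IH by (simp add: grid_step_def)
qed simp

lemma grid_chain_invariant:
  assumes "s \<in> S" "\<And>e s. e \<in> E \<Longrightarrow> s \<in> S \<Longrightarrow> f e s \<in> S"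
  shows "grid_chain f E d s k \<in> S"
proof (induction k)
  case (Suc k)
  show ?case
  proof (cases "\<exists>e. sole_ring E (\<lambda>e. d (e, k)) e")
    case True
    then obtain e where e: "sole_ring E (\<lambda>e. d (e, k)) e" by auto
    then have "e \<in> E" by (simp add: sole_ring_def)
    with Suc assms(2) show ?thesis by (simp add: grid_step_sole_ring[OF e])
  next
    case False
    with Suc show ?thesis by (simp add: grid_step_def)
  qed
qed (use assms in simp)

text \<open>At most one of the indicators is nonzero. The linear form lets expectations be taken
  edge by edge, which produces the generator sum.\<close>

lemma grid_step_telescope:
  fixes q :: "'s \<Rightarrow> real"
  assumes "finite E"
  shows "q (grid_step f E u s) = q s + (\<Sum>e\<in>E. of_bool (sole_ring E u e) * (q (f e s) - q s))"
proof (cases "\<exists>e. sole_ring E u e")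
  case True
  then obtain e where e: "sole_ring E u e" by auto
  have "sole_ring E u e' \<longleftrightarrow> e' = e" for e'
    using e sole_ring_unique[OF e] by blast
  then have "(\<Sum>e'\<in>E. of_bool (sole_ring E u e') * (q (f e' s) - q s))
      = (\<Sum>e'\<in>E. if e' = e then q (f e s) - q s else 0)"
    by (intro sum.cong) auto
  then show ?thesis using e assms by (simp add: grid_step_sole_ring[OF e] sole_ring_def)
qed (simp add: grid_step_def)

text \<open>The states carry no sigma-algebra. Measurability is automatic because the state is a
  function of finitely many natural numbers, whose product space is discrete.\<close>

lemma borel_measurable_grid_chain:
  fixes h :: "'s \<Rightarrow> real"
  assumes "finite E" and D: "\<And>i. i \<in> E \<times> {..<k} \<Longrightarrow> D i \<in> measurable M (count_space UNIV)"
  shows "(\<lambda>\<omega>. h (grid_chain f E (\<lambda>i. D i \<omega>) s k)) \<in> borel_measurable M"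
proof -
  let ?P = "E \<times> {..<k}"
  have "(\<lambda>\<omega>. restrict (\<lambda>i. D i \<omega>) ?P) \<in> measurable M (\<Pi>\<^sub>M i\<in>?P. count_space UNIV)"
    by (rule measurable_restrict) (rule D)
  then have "(\<lambda>\<omega>. restrict (\<lambda>i. D i \<omega>) ?P) \<in> measurable M (count_space (?P \<rightarrow>\<^sub>E UNIV))"
    using \<open>finite E\<close> by (simp add: count_space_PiM_finite)
  then have "(\<lambda>\<omega>. h (grid_chain f E (restrict (\<lambda>i. D i \<omega>) ?P) s k)) \<in> borel_measurable M"
    by (rule measurable_compose) simp
  then show ?thesis by (simp only: grid_chain_restrict[OF order_refl])
qed

text \<open>The state is a function of past increments and the indicator of a sole ring one of the
  increments of step \<open>k\<close>, so the two are independent and the expectation of their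
  product factorises. The factor \<open>p * (1 - p) ^ (card E - 1)\<close> is the probability that a
  given edge rings and all others are silent.\<close>

lemma (in prob_space) expectation_grid_chain_Suc:
  fixes q :: "'s \<Rightarrow> real" and D :: "'e \<times> nat \<Rightarrow> 'a \<Rightarrow> nat"
  assumes fin: "finite E"
    and indep: "indep_vars (\<lambda>_. count_space UNIV) D (E \<times> {..<K})"
    and silent: "\<And>e. e \<in> E \<Longrightarrow> prob {\<omega> \<in> space M. D (e, k) \<omega> = 0} = 1 - p"
    and k: "k < K" and S: "s \<in> S" "\<And>e s. e \<in> E \<Longrightarrow> s \<in> S \<Longrightarrow> f e s \<in> S"
    and q: "\<And>s. s \<in> S \<Longrightarrow> \<bar>q s\<bar> \<le> C"
  defines "\<zeta> \<equiv> \<lambda>k \<omega>. grid_chain f E (\<lambda>i. D i \<omega>) s k"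
  shows "expectation (\<lambda>\<omega>. q (\<zeta> (Suc k) \<omega>)) = expectation (\<lambda>\<omega>. q (\<zeta> k \<omega>)) +
    p * (1 - p) ^ (card E - 1) * expectation (\<lambda>\<omega>. \<Sum>e\<in>E. q (f e (\<zeta> k \<omega>)) - q (\<zeta> k \<omega>))"
proof -
  let ?P = "E \<times> {..<k}" and ?Q = "E \<times> {k}"
  have D: "D i \<in> measurable M (count_space UNIV)" if "i \<in> E \<times> {..<K}" for i
    using indep that by (auto simp: indep_vars_def)
  have PQ: "indep_var (count_space (?P \<rightarrow>\<^sub>E UNIV)) (\<lambda>\<omega>. restrict (\<lambda>i. D i \<omega>) ?P)
      (count_space (?Q \<rightarrow>\<^sub>E UNIV)) (\<lambda>\<omega>. restrict (\<lambda>i. D i \<omega>) ?Q)"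
  proof -
    have "indep_var (PiM ?P (\<lambda>_. count_space UNIV)) (\<lambda>\<omega>. restrict (\<lambda>i. D i \<omega>) ?P)
        (PiM ?Q (\<lambda>_. count_space UNIV)) (\<lambda>\<omega>. restrict (\<lambda>i. D i \<omega>) ?Q)"
      by (rule indep_var_restrict[OF indep]) (use k in auto)
    then show ?thesis using fin by (simp add: count_space_PiM_finite)
  qed
  have \<zeta>_S: "\<zeta> k \<omega> \<in> S" for \<omega> k
    unfolding \<zeta>_def by (intro grid_chain_invariant S)
  have \<zeta>_meas: "(\<lambda>\<omega>. h (\<zeta> k \<omega>)) \<in> borel_measurable M" for h :: "'s \<Rightarrow> real"
    unfolding \<zeta>_def using k by (intro borel_measurable_grid_chain fin D) auto
  have integ: "integrable M (\<lambda>\<omega>. q (\<zeta> k \<omega>))" "\<And>e. e \<in> E \<Longrightarrow> integrable M (\<lambda>\<omega>. q (f e (\<zeta> k \<omega>)))"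
    using q \<zeta>_S S
    by (auto intro!: integrable_const_bound[where B=C] \<zeta>_meas[of q] \<zeta>_meas[of "\<lambda>s. q (f e s)" for e])
  have sole: "indep_var borel (\<lambda>\<omega>. q (f e (\<zeta> k \<omega>)) - q (\<zeta> k \<omega>))
      borel (\<lambda>\<omega>. of_bool (sole_ring E (\<lambda>e. D (e, k) \<omega>) e) :: real)" for e
  proof -
    have "indep_var borel ((\<lambda>d. q (f e (grid_chain f E d s k)) - q (grid_chain f E d s k)) \<circ>
          (\<lambda>\<omega>. restrict (\<lambda>i. D i \<omega>) ?P))
        borel ((\<lambda>d. of_bool (sole_ring E (\<lambda>e. d (e, k)) e) :: real) \<circ> (\<lambda>\<omega>. restrict (\<lambda>i. D i \<omega>) ?Q))"
      by (rule indep_var_compose[OF PQ]) auto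
    moreover have "sole_ring E (\<lambda>e. restrict (\<lambda>i. D i \<omega>) ?Q (e, k)) = sole_ring E (\<lambda>e. D (e, k) \<omega>)" for \<omega>
      by (intro ext sole_ring_cong) auto
    ultimately show ?thesis
      by (simp only: comp_def grid_chain_restrict[OF order_refl] \<zeta>_def)
  qed
  have sole_meas: "{\<omega> \<in> space M. sole_ring E (\<lambda>e. D (e, k) \<omega>) e} \<in> events" for e
  proof -
    have "(\<lambda>\<omega>. of_bool (sole_ring E (\<lambda>e. D (e, k) \<omega>) e) :: real) -` {1} \<inter> space M \<in> events"
      by (rule measurable_sets[OF indep_var_rv2[OF sole[of e]]]) simp
    also have "(\<lambda>\<omega>. of_bool (sole_ring E (\<lambda>e. D (e, k) \<omega>) e) :: real) -` {1} \<inter> space M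
        = {\<omega> \<in> space M. sole_ring E (\<lambda>e. D (e, k) \<omega>) e}" by auto
    finally show ?thesis .
  qed
  have prob_sole: "prob {\<omega> \<in> space M. sole_ring E (\<lambda>e. D (e, k) \<omega>) e} = p * (1 - p) ^ (card E - 1)"
    if e: "e \<in> E" for e
  proof -
    \<comment> \<open>A sole ring of \<open>e\<close> is a rectangle event: a positive increment at
      \<open>e\<close> and zero at every other edge.\<close>
    define A :: "'e \<times> nat \<Rightarrow> nat set" where "A = (\<lambda>(e', _). if e' = e then {0<..} else {0})"
    have "{\<omega> \<in> space M. sole_ring E (\<lambda>e. D (e, k) \<omega>) e} = (\<Inter>i\<in>?Q. D i -` A i \<inter> space M)"
    proof -
      have "sole_ring E u e \<longleftrightarrow> (\<forall>e'\<in>E. u e' \<in> A (e', k))" for u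
        using e unfolding sole_ring_def A_def by (simp add: Ball_def) blast
      then show ?thesis using e by auto
    qed
    also have "prob \<dots> = (\<Prod>i\<in>?Q. prob (D i -` A i \<inter> space M))"
      by (rule indep_varsD[OF indep]) (use fin e k in auto)
    also have "\<dots> = (\<Prod>e'\<in>E. prob (D (e', k) -` A (e', k) \<inter> space M))"
      by (intro prod.reindex_bij_witness[of _ "\<lambda>e. (e, k)" fst]) auto
    also have "\<dots> = (\<Prod>e'\<in>E. if e' = e then p else 1 - p)"
    proof (rule prod.cong[OF refl])
      fix e' assume e': "e' \<in> E"
      have 0: "D (e', k) -` {0} \<inter> space M = {\<omega> \<in> space M. D (e', k) \<omega> = 0}" by auto
      have ev: "{\<omega> \<in> space M. D (e', k) \<omega> = 0} \<in> events"
        unfolding 0[symmetric] by (rule measurable_sets[OF D]) (use e' k in auto)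
      have 1: "D (e', k) -` {0<..} \<inter> space M = space M - {\<omega> \<in> space M. D (e', k) \<omega> = 0}" by auto
      show "prob (D (e', k) -` A (e', k) \<inter> space M) = (if e' = e then p else 1 - p)"
      proof (cases "e' = e")
        case True
        then have "A (e', k) = {0<..}" by (simp add: A_def)
        then have "prob (D (e', k) -` A (e', k) \<inter> space M) = prob (space M - {\<omega> \<in> space M. D (e', k) \<omega> = 0})"
          by (simp only: 1)
        then show ?thesis using True silent[OF e'] prob_compl[OF ev] by simp
      next
        case False
        then have "A (e', k) = {0}" by (simp add: A_def)
        then show ?thesis using False silent[OF e'] by (simp add: 0)
      qed
    qed
    also have "\<dots> = p * (1 - p) ^ (card E - 1)"
    proof -
      have "(\<Prod>e'\<in>E - {e}. if e' = e then p else 1 - p) = (\<Prod>e'\<in>E - {e}. 1 - p)"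
        by (rule prod.cong) auto
      then show ?thesis using e fin by (subst prod.remove[of _ e]) auto
    qed
    finally show ?thesis .
  qed
  have "expectation (\<lambda>\<omega>. (q (f e (\<zeta> k \<omega>)) - q (\<zeta> k \<omega>)) * of_bool (sole_ring E (\<lambda>e. D (e, k) \<omega>) e))
      = p * (1 - p) ^ (card E - 1) * expectation (\<lambda>\<omega>. q (f e (\<zeta> k \<omega>)) - q (\<zeta> k \<omega>))"
    and "integrable M (\<lambda>\<omega>. (q (f e (\<zeta> k \<omega>)) - q (\<zeta> k \<omega>)) * of_bool (sole_ring E (\<lambda>e. D (e, k) \<omega>) e))"
    if e: "e \<in> E" for e
  proof -
    have ind: "of_bool (sole_ring E (\<lambda>e. D (e, k) \<omega>) e) = indicat_real {\<omega> \<in> space M. sole_ring E (\<lambda>e. D (e, k) \<omega>) e} \<omega>"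
      if "\<omega> \<in> space M" for \<omega>
      using that by (simp add: indicator_def)
    have int2: "integrable M (\<lambda>\<omega>. of_bool (sole_ring E (\<lambda>e. D (e, k) \<omega>) e) :: real)"
      using sole_meas[of e] by (subst Bochner_Integration.integrable_cong[OF refl ind]) (auto simp: emeasure_eq_measure)
    have "expectation (\<lambda>\<omega>. of_bool (sole_ring E (\<lambda>e. D (e, k) \<omega>) e)) = p * (1 - p) ^ (card E - 1)"
      using sole_meas[of e] prob_sole[OF e] by (subst Bochner_Integration.integral_cong[OF refl ind]) auto
    then show "expectation (\<lambda>\<omega>. (q (f e (\<zeta> k \<omega>)) - q (\<zeta> k \<omega>)) * of_bool (sole_ring E (\<lambda>e. D (e, k) \<omega>) e))
      = p * (1 - p) ^ (card E - 1) * expectation (\<lambda>\<omega>. q (f e (\<zeta> k \<omega>)) - q (\<zeta> k \<omega>))"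
      using indep_var_lebesgue_integral[OF sole] integ e int2 by simp
    show "integrable M (\<lambda>\<omega>. (q (f e (\<zeta> k \<omega>)) - q (\<zeta> k \<omega>)) * of_bool (sole_ring E (\<lambda>e. D (e, k) \<omega>) e))"
      using indep_var_integrable[OF sole] integ e int2 by simp
  qed note E1 = this(1) and I1 = this(2)
  have "q (\<zeta> (Suc k) \<omega>) = q (\<zeta> k \<omega>) +
      (\<Sum>e\<in>E. (q (f e (\<zeta> k \<omega>)) - q (\<zeta> k \<omega>)) * of_bool (sole_ring E (\<lambda>e. D (e, k) \<omega>) e))" for \<omega>
    unfolding \<zeta>_def grid_chain.simps by (subst grid_step_telescope[OF fin]) (simp add: mult.commute)
  then have "expectation (\<lambda>\<omega>. q (\<zeta> (Suc k) \<omega>)) = expectation (\<lambda>\<omega>. q (\<zeta> k \<omega>)) +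
      (\<Sum>e\<in>E. expectation (\<lambda>\<omega>. (q (f e (\<zeta> k \<omega>)) - q (\<zeta> k \<omega>)) * of_bool (sole_ring E (\<lambda>e. D (e, k) \<omega>) e)))"
    using integ I1 by simp
  also have "\<dots> = expectation (\<lambda>\<omega>. q (\<zeta> k \<omega>)) +
      p * (1 - p) ^ (card E - 1) * (\<Sum>e\<in>E. expectation (\<lambda>\<omega>. q (f e (\<zeta> k \<omega>)) - q (\<zeta> k \<omega>)))"
    using E1 by (simp add: sum_distrib_left)
  also have "(\<Sum>e\<in>E. expectation (\<lambda>\<omega>. q (f e (\<zeta> k \<omega>)) - q (\<zeta> k \<omega>)))
      = expectation (\<lambda>\<omega>. \<Sum>e\<in>E. q (f e (\<zeta> k \<omega>)) - q (\<zeta> k \<omega>))"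
    using integ by (intro Bochner_Integration.integral_sum[symmetric]) auto
  finally show ?thesis .
qed

section \<open>Averaging along counting paths\<close>

text \<open>Takes the unordered edge as argument, as \<open>grid_chain\<close> requires; halving the
  sum gives the average because edges have two elements.\<close>

definition edge_op :: "'v set \<Rightarrow> ('v \<Rightarrow> real) \<Rightarrow> 'v \<Rightarrow> real" where
  "edge_op e \<eta> = (\<lambda>x. if x \<in> e then (\<Sum>y\<in>e. \<eta> y) / 2 else \<eta> x)"

lemma edge_op_pair: "x \<noteq> y \<Longrightarrow> edge_op {x, y} = edge_average x y"
  by (auto simp: edge_op_def edge_average_def fun_eq_iff)

lemma edge_average_prob_mass:
  assumes "finite V" "x \<in> V" "y \<in> V" "x \<noteq> y" "\<eta> \<in> prob_mass_functions V"
  shows "edge_average x y \<eta> \<in> prob_mass_functions V"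
proof -
  let ?U = "V - {x, y}"
  have split: "(\<Sum>z\<in>V. \<zeta> z) = \<zeta> x + \<zeta> y + (\<Sum>z\<in>?U. \<zeta> z)" for \<zeta> :: "'a \<Rightarrow> real"
    using assms sum.subset_diff[of "{x, y}" V \<zeta>] by simp
  have "(\<Sum>z\<in>?U. edge_average x y \<eta> z) = (\<Sum>z\<in>?U. \<eta> z)"
    by (rule sum.cong) (auto simp: edge_average_def)
  then have "(\<Sum>z\<in>V. edge_average x y \<eta> z) = (\<Sum>z\<in>V. \<eta> z)"
    unfolding split using assms by (simp add: edge_average_def)
  then show ?thesis
    using assms by (auto simp: prob_mass_functions_def edge_average_def)
qed

lemma ring_times_le_imp_eq:
  assumes mono: "\<And>u v. 0 \<le> u \<Longrightarrow> u \<le> v \<Longrightarrow> c u \<le> c v" and "0 \<le> s" "c s = c t"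
  shows "ring_times c \<inter> {s<..t} = {}"
proof -
  have False if "r \<in> ring_times c" "s < r" "r \<le> t" for r
  proof -
    have "c s < c r" using that \<open>0 \<le> s\<close> by (auto simp: ring_times_def)
    also have "\<dots> \<le> c t" using that \<open>0 \<le> s\<close> by (intro mono) auto
    finally show False using \<open>c s = c t\<close> by simp
  qed
  then show ?thesis by auto
qed

text \<open>The ring is the infimum of the times at which the path exceeds \<open>c s\<close>.
  Right-continuity of an integer-valued path means that it is constant just after each time, so the
  infimum is attained. A second ring would raise the path by at least two.\<close>

lemma unit_increment_unique_ring:
  assumes mono: "\<And>u v. 0 \<le> u \<Longrightarrow> u \<le> v \<Longrightarrow> c u \<le> c v"
    and cont: "\<And>u. 0 \<le> u \<Longrightarrow> continuous (at_right u) c"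
    and st: "0 \<le> s" "s \<le> t" and unit: "c t = Suc (c s)"
  obtains r where "s < r" "r \<le> t" "ring_times c \<inter> {s<..t} = {r}"
proof -
  define R where "R = {u. s \<le> u \<and> c s < c u}"
  define r where "r = Inf R"
  have tR: "t \<in> R" using st unit by (simp add: R_def)
  have bdd: "bdd_below R" by (auto simp: R_def)
  have "s \<le> r" "r \<le> t"
    unfolding r_def using tR bdd by (auto intro!: cInf_greatest cInf_lower) (auto simp: R_def)
  have below: "c u \<le> c s" if "s \<le> u" "u < r" for u
    using that bdd cInf_lower[of u R] by (fastforce simp: R_def r_def)
  have right: "eventually (\<lambda>u. c u = c r) (at_right r)"
    using cont[of r] \<open>0 \<le> s\<close> \<open>s \<le> r\<close>
    by (auto simp: continuous_within tendsto_discrete)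
  have cr: "c s < c r"
  proof -
    obtain b where b: "r < b" "\<And>u. r < u \<Longrightarrow> u < b \<Longrightarrow> c u = c r"
      using right unfolding eventually_at_right_field by auto
    then obtain u where u: "u \<in> R" "u < b"
      using tR cInf_lessD[of R b] by (auto simp: r_def)
    have "r \<le> u" using u(1) bdd by (simp add: r_def cInf_lower)
    then have "c u = c r" using b u by (cases "u = r") auto
    then show ?thesis using u by (simp add: R_def)
  qed
  then have "s < r" using \<open>s \<le> r\<close> by (cases "s = r") auto
  have "r \<in> ring_times c"
  proof -
    have "c u < c r" if "0 \<le> u" "u < r" for u
    proof -
      have "c u \<le> c (max s u)" using that by (intro mono) auto
      also have "\<dots> \<le> c s" using that \<open>s < r\<close> by (intro below) auto
      finally show ?thesis using cr by simp
    qed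
    then show ?thesis using \<open>s < r\<close> st by (simp add: ring_times_def)
  qed
  moreover have "u = r" if "u \<in> ring_times c" "s < u" "u \<le> t" for u
  proof (rule ccontr)
    assume "u \<noteq> r"
    have "c s < c u" using that st by (auto simp: ring_times_def)
    then have "r < u" using below[of u] that \<open>u \<noteq> r\<close> by fastforce
    then have "c r < c u" using that \<open>s < r\<close> st by (auto simp: ring_times_def)
    moreover have "c u \<le> c t" using that st by (intro mono) auto
    ultimately show False using cr unit by simp
  qed
  ultimately have "ring_times c \<inter> {s<..t} = {r}"
    using \<open>s < r\<close> \<open>r \<le> t\<close>
    unfolding set_eq_iff Int_iff greaterThanAtMost_iff singleton_iff by blast
  with \<open>s < r\<close> \<open>r \<le> t\<close> show ?thesis by (rule that)
qed

lemma averaging_path_grid_step: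
  assumes path: "averaging_path E c p"
    and mono: "\<And>e u v. e \<in> E \<Longrightarrow> 0 \<le> u \<Longrightarrow> u \<le> v \<Longrightarrow> c e u \<le> c e v"
    and cont: "\<And>e u. e \<in> E \<Longrightarrow> 0 \<le> u \<Longrightarrow> continuous (at_right u) (c e)"
    and edges: "\<And>e. e \<in> E \<Longrightarrow> \<exists>x y. e = {x, y} \<and> x \<noteq> y"
    and st: "0 \<le> s" "s \<le> t"
    and few: "\<And>e. e \<in> E \<Longrightarrow> c e t - c e s \<le> 1"
      "\<And>e e'. e \<in> E \<Longrightarrow> e' \<in> E \<Longrightarrow> e \<noteq> e' \<Longrightarrow> c e t - c e s = 0 \<or> c e' t - c e' s = 0"
  shows "p t = grid_step edge_op E (\<lambda>e. c e t - c e s) (p s)"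
proof (cases "\<exists>e. sole_ring E (\<lambda>e. c e t - c e s) e")
  case True
  then obtain e where e: "sole_ring E (\<lambda>e. c e t - c e s) e" by auto
  then have eE: "e \<in> E" and "c e t = Suc (c e s)"
    using few(1)[of e] by (auto simp: sole_ring_def)
  then obtain r where r: "s < r" "r \<le> t" "ring_times (c e) \<inter> {s<..t} = {r}"
    using unit_increment_unique_ring[of "c e" s t] mono cont st by blast
  have other: "ring_times (c e') \<inter> {s<..t} = {}" if "e' \<in> E" "e' \<noteq> e" for e'
  proof -
    have "c e' t - c e' s = 0" using e that by (auto simp: sole_ring_def)
    moreover have "c e' s \<le> c e' t" using mono that st by auto
    ultimately have "c e' s = c e' t" by simp
    then show ?thesis using ring_times_le_imp_eq[of "c e'" s t] mono that st by auto
  qed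
  obtain x y where xy: "e = {x, y}" "x \<noteq> y" using edges[OF eE] by auto
  \<comment> \<open>The averaging clause of \<open>averaging_path\<close> covers the passage from
    \<open>s\<close> to the ring \<open>r\<close>, the constancy clause that from \<open>r\<close>
    to \<open>t\<close>.\<close>
  have "ring_times (c e') \<inter> {s<..<r} = {}" "ring_times (c e') \<inter> {r<..t} = {}" if "e' \<in> E" for e'
    using other[OF that] r by (cases "e' = e"; fastforce)+
  then have "p r = edge_average x y (p s)" "p t = p r"
    using path r st eE unfolding averaging_path_def xy(1) by (blast, auto)
  then show ?thesis using e xy by (simp add: grid_step_sole_ring edge_op_pair)
next
  case False
  \<comment> \<open>An edge that rings without being the only one has a companion that rings too,
    against \<open>few(2)\<close>.\<close>
  have "c e s = c e t" if "e \<in> E" for e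
    using False that few(2)[OF that] mono[of e s t] st unfolding sole_ring_def
    by (metis Diff_iff bot_nat_0.not_eq_extremum diff_is_0_eq insertCI le_antisym)
  then have "ring_times (c e) \<inter> {s<..t} = {}" if "e \<in> E" for e
    using that mono st by (intro ring_times_le_imp_eq) auto
  then have "p t = p s" using path st unfolding averaging_path_def by blast
  then show ?thesis using False by (simp add: grid_step_def)
qed

section \<open>Increments of independent Poisson clocks\<close>

lemma measurable_diff_nat:
  fixes f g :: "'a \<Rightarrow> nat"
  assumes [measurable]: "f \<in> measurable M (count_space UNIV)" "g \<in> measurable M (count_space UNIV)"
  shows "(\<lambda>x. f x - g x) \<in> measurable M (count_space UNIV)"
  by measurable

definition clock_increment :: "('e \<Rightarrow> real \<Rightarrow> 'w \<Rightarrow> nat) \<Rightarrow> real \<Rightarrow> 'e \<times> nat \<Rightarrow> 'w \<Rightarrow> nat" where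
  "clock_increment N h i \<omega> = N (fst i) (h * real (Suc (snd i))) \<omega> - N (fst i) (h * real (snd i)) \<omega>"

text \<open>The pairs \<open>e = e'\<close> account for a clock ringing twice. In a step that is not crowded at most one
  edge rings, exactly once, so the discretised dynamics agrees with the averaging process.\<close>

definition crowded :: "'e set \<Rightarrow> ('e \<Rightarrow> nat) \<Rightarrow> bool" where
  "crowded E u \<longleftrightarrow> (\<exists>e\<in>E. \<exists>e'\<in>E. if e = e' then 2 \<le> u e else 0 < u e \<and> 0 < u e')"

context prob_space
begin

text \<open>Whole paths of different edges are independent, and so are the increments of one edge
  over disjoint steps; \<open>indep_vars_nested\<close> merges the two. The increments factor
  through paths restricted to \<open>{0..}\<close> because all grid times are nonnegative.\<close>

lemma indep_clock_increments:
  assumes clocks: "independent_poisson_clocks M r E N" and "finite E" "0 \<le> h"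
  shows "indep_vars (\<lambda>_. count_space UNIV) (clock_increment N h) (E \<times> {..<K})"
proof -
  define g where "g k c = c (h * real (Suc k)) - c (h * real k)" for k and c :: "real \<Rightarrow> nat"
  define path where "path e \<omega> = (\<lambda>t\<in>{0..}. N e t \<omega>)" for e \<omega>
  let ?P = "\<Pi>\<^sub>M t\<in>{0..}. count_space (UNIV :: nat set)"
  have pos: "0 \<le> h * real j" for j using \<open>0 \<le> h\<close> by simp
  have g_path: "g k (path e \<omega>) = N e (h * real (Suc k)) \<omega> - N e (h * real k) \<omega>" for e k \<omega>
    unfolding g_def path_def using pos[of k] pos[of "Suc k"] by (simp del: of_nat_Suc)
  have path: "indep_vars (\<lambda>_. ?P) path E"
    using clocks by (simp add: independent_poisson_clocks_def path_def[abs_def])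
  have g: "g k \<in> measurable ?P (count_space UNIV)" for k
  proof -
    have "(\<lambda>c. c (h * real j)) \<in> measurable ?P (count_space UNIV)" for j
      using pos by (intro measurable_component_singleton) auto
    from measurable_diff_nat[OF this[of "Suc k"] this[of k]]
    show ?thesis by (simp add: g_def[abs_def])
  qed
  have incr: "indep_vars (\<lambda>_. count_space UNIV) (\<lambda>k \<omega>. g k (path e \<omega>)) {..<K}" if "e \<in> E" for e
  proof -
    have "poisson_process M r (N e)"
      using clocks that by (simp add: independent_poisson_clocks_def)
    then have "\<forall>(\<tau> :: nat \<Rightarrow> real) k. 0 \<le> \<tau> 0 \<and> mono \<tau> \<longrightarrow>
        indep_vars (\<lambda>_. count_space UNIV) (\<lambda>i \<omega>. N e (\<tau> (Suc i)) \<omega> - N e (\<tau> i) \<omega>) {..<k}"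
      unfolding poisson_process_def by (elim conjE)
    then have "0 \<le> h * real 0 \<and> mono (\<lambda>k. h * real k) \<longrightarrow>
        indep_vars (\<lambda>_. count_space UNIV) (\<lambda>k \<omega>. g k (path e \<omega>)) {..<K}"
      unfolding g_path by (elim allE)
    moreover have "mono (\<lambda>k. h * real k)"
      using \<open>0 \<le> h\<close> by (auto intro!: monoI mult_left_mono)
    ultimately show ?thesis using pos[of 0] by blast
  qed
  have "clock_increment N h = (\<lambda>ij \<omega>. g (snd ij) (path (fst ij) \<omega>))"
    by (simp add: fun_eq_iff g_path clock_increment_def)
  then show ?thesis
    using indep_vars_nested[where g="\<lambda>_. g" and Q="\<lambda>_ _. count_space UNIV",
        OF path \<open>finite E\<close> finite_lessThan g incr] by simp
qed

lemma measurable_clock_increment: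
  assumes "independent_poisson_clocks M r E N" "0 \<le> h" "fst i \<in> E"
  shows "clock_increment N h i \<in> measurable M (count_space UNIV)"
proof -
  have "N (fst i) (h * real j) \<in> measurable M (count_space UNIV)" for j
    using assms by (auto simp: independent_poisson_clocks_def poisson_process_def)
  from measurable_diff_nat[OF this[of "Suc (snd i)"] this[of "snd i"]]
  show ?thesis by (simp add: clock_increment_def[abs_def])
qed

lemma prob_clock_increment:
  assumes clocks: "independent_poisson_clocks M r E N" and "0 < h" "fst i \<in> E"
  shows "prob {\<omega> \<in> space M. clock_increment N h i \<omega> \<in> A} = measure (poisson_pmf (r * h)) A"
proof -
  have "poisson_process M r (N (fst i))"
    using assms by (simp add: independent_poisson_clocks_def)
  then have "distr M (count_space UNIV) (clock_increment N h i)
      = measure_pmf (poisson_pmf (r * (h * real (Suc (snd i)) - h * real (snd i))))"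
    using \<open>0 < h\<close> unfolding poisson_process_def clock_increment_def[abs_def] by (auto simp: algebra_simps)
  also have "h * real (Suc (snd i)) - h * real (snd i) = h"
    by (simp add: algebra_simps)
  finally have "measure (poisson_pmf (r * h)) A = measure (distr M (count_space UNIV) (clock_increment N h i)) A"
    by simp
  also have "\<dots> = prob {\<omega> \<in> space M. clock_increment N h i \<omega> \<in> A}"
    using assms by (subst measure_distr)
      (auto intro!: measurable_clock_increment arg_cong[where f=prob])
  finally show ?thesis ..
qed

end

text \<open>Both tail bounds come from \<open>1 - x \<le> exp (- x)\<close>; for
  \<open>{2..}\<close> it gives
  \<open>1 - exp (- x) * (1 + x) \<le> 1 - (1 - x) * (1 + x)\<close>.\<close>

lemma poisson_pmf_tails:
  assumes "0 < x"
  shows "measure (poisson_pmf x) {0} = exp (- x)"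
    and "measure (poisson_pmf x) {1..} \<le> x"
    and "measure (poisson_pmf x) {2..} \<le> x\<^sup>2"
proof -
  show p0: "measure (poisson_pmf x) {0} = exp (- x)"
    using pmf_poisson[OF assms] by (simp add: measure_pmf_single)
  have p1: "measure (poisson_pmf x) {0, 1} = exp (- x) * (1 + x)"
    using pmf_poisson[OF assms] by (subst measure_measure_pmf_finite) (auto simp: algebra_simps)
  have c: "measure (poisson_pmf x) (- A) = 1 - measure (poisson_pmf x) A" for A
    using measure_pmf.prob_compl[of A "poisson_pmf x"] by (simp add: Compl_eq_Diff_UNIV)
  have "{1..} = - {0 :: nat}" "{2..} = - {0, 1 :: nat}" by auto
  moreover have "1 - x \<le> exp (- x)" using exp_ge_add_one_self[of "- x"] by simp
  moreover from this have "(1 - x) * (1 + x) \<le> exp (- x) * (1 + x)"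
    using assms by (intro mult_right_mono) auto
  ultimately show "measure (poisson_pmf x) {1..} \<le> x" "measure (poisson_pmf x) {2..} \<le> x\<^sup>2"
    by (simp_all add: c p0 p1 del: One_nat_def) (simp_all add: algebra_simps power2_eq_square)
qed

context prob_space
begin

text \<open>A union bound over the steps and the pairs of edges, each pair costing
  \<open>(r * h)\<^sup>2\<close>. With \<open>h = t / K\<close> the total is of order
  \<open>1 / K\<close>.\<close>

lemma prob_crowded_le:
  fixes K :: nat
  assumes clocks: "independent_poisson_clocks M r E N" and "finite E" "0 < r" "0 < h"
  defines "B \<equiv> {\<omega> \<in> space M. \<exists>k<K. crowded E (\<lambda>e. clock_increment N h (e, k) \<omega>)}"
  shows "B \<in> events" "prob B \<le> real K * (real (card E))\<^sup>2 * (r * h)\<^sup>2"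
proof -
  let ?D = "clock_increment N h"
  define F where "F = (\<lambda>(k, e, e'). if e = e' then {\<omega> \<in> space M. ?D (e, k) \<omega> \<in> {2..}}
    else {\<omega> \<in> space M. ?D (e, k) \<omega> \<in> {1..}} \<inter> {\<omega> \<in> space M. ?D (e', k) \<omega> \<in> {1..}})"
  have ev: "{\<omega> \<in> space M. ?D (e, k) \<omega> \<in> A} \<in> events" if "e \<in> E" for e k A
  proof -
    have "?D (e, k) -` A \<inter> space M \<in> events"
      using that clocks \<open>0 < h\<close> by (intro measurable_sets[OF measurable_clock_increment]) auto
    moreover have "?D (e, k) -` A \<inter> space M = {\<omega> \<in> space M. ?D (e, k) \<omega> \<in> A}" by auto
    ultimately show ?thesis by simp
  qed
  have B: "B = (\<Union>x\<in>{..<K} \<times> E \<times> E. F x)"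
  proof -
    define Q where "Q k e e' \<omega> \<longleftrightarrow> (if e = e' then 2 \<le> ?D (e, k) \<omega> else 0 < ?D (e, k) \<omega> \<and> 0 < ?D (e', k) \<omega>)" for k e e' \<omega>
    have "F (k, e, e') = {\<omega> \<in> space M. Q k e e' \<omega>}" for k e e'
      by (auto simp: F_def Q_def)
    moreover have "B = {\<omega> \<in> space M. \<exists>k<K. \<exists>e\<in>E. \<exists>e'\<in>E. Q k e e' \<omega>}"
      unfolding B_def crowded_def Q_def ..
    ultimately show ?thesis by (auto simp: Bex_def; blast)
  qed
  have F: "F x \<in> events" if "x \<in> {..<K} \<times> E \<times> E" for x
    using that ev unfolding F_def by (auto simp del: atLeast_iff)
  show "B \<in> events" unfolding B using F \<open>finite E\<close> by (intro sets.finite_UN) auto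
  have rh: "0 < r * h" using assms by simp
  have Fx: "prob (F x) \<le> (r * h)\<^sup>2" if x: "x \<in> {..<K} \<times> E \<times> E" for x
  proof -
    obtain k e e' where [simp]: "x = (k, e, e')" by (cases x) auto
    have k: "k < K" "e \<in> E" "e' \<in> E" using x by auto
    show ?thesis
    proof (cases "e = e'")
      case True
      then show ?thesis
        using k prob_clock_increment[OF clocks \<open>0 < h\<close>, of "(e, k)" "{2..}"] poisson_pmf_tails(3)[OF rh]
        by (simp add: F_def)
    next
      case False
      let ?A = "\<lambda>i. ?D i -` {1..} \<inter> space M"
      have "prob (F x) = prob (\<Inter>i\<in>{(e, k), (e', k)}. ?A i)"
        using False by (auto simp: F_def intro!: arg_cong[where f=prob])
      also have "\<dots> = (\<Prod>i\<in>{(e, k), (e', k)}. prob (?A i))"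
        using k assms by (intro indep_varsD[OF indep_clock_increments[OF clocks]]) auto
      also have "\<dots> = prob (?A (e, k)) * prob (?A (e', k))" using False by simp
      also have "prob (?A (f, k)) \<le> r * h" if "f \<in> E" for f
      proof -
        have "?A (f, k) = {\<omega> \<in> space M. ?D (f, k) \<omega> \<in> {1..}}" by auto
        then show ?thesis
          using that prob_clock_increment[OF clocks \<open>0 < h\<close>, of "(f, k)" "{1..}"] poisson_pmf_tails(2)[OF rh]
          by simp
      qed
      then have "prob (?A (e, k)) * prob (?A (e', k)) \<le> (r * h) * (r * h)"
        using k rh by (intro mult_mono) auto
      finally show ?thesis by (simp add: power2_eq_square)
    qed
  qed
  have "prob B \<le> (\<Sum>x\<in>{..<K} \<times> E \<times> E. prob (F x))"
    unfolding B using F \<open>finite E\<close> by (intro finite_measure_subadditive_finite) auto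
  also have "\<dots> \<le> (\<Sum>x\<in>{..<K} \<times> E \<times> E. (r * h)\<^sup>2)"
    by (intro sum_mono Fx)
  finally show "prob B \<le> real K * (real (card E))\<^sup>2 * (r * h)\<^sup>2"
    by (simp add: card_cartesian_product power2_eq_square mult.assoc)
qed

end

section \<open>Comparison of the averaging process with the grid chain\<close>

lemma averaging_path_grid_chain:
  assumes path: "averaging_path E (\<lambda>e u. N e u \<omega>) p"
    and mono: "\<And>e u v. e \<in> E \<Longrightarrow> 0 \<le> u \<Longrightarrow> u \<le> v \<Longrightarrow> N e u \<omega> \<le> N e v \<omega>"
    and cont: "\<And>e u. e \<in> E \<Longrightarrow> 0 \<le> u \<Longrightarrow> continuous (at_right u) (\<lambda>u. N e u \<omega>)"
    and edges: "\<And>e. e \<in> E \<Longrightarrow> \<exists>x y. e = {x, y} \<and> x \<noteq> y"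
    and h: "0 \<le> h"
    and few: "\<And>k. k < K \<Longrightarrow> \<not> crowded E (\<lambda>e. clock_increment N h (e, k) \<omega>)"
  shows "p (h * real K) = grid_chain edge_op E (\<lambda>i. clock_increment N h i \<omega>) (p 0) K"
  using few
proof (induction K)
  case (Suc k)
  have nc: "\<not> crowded E (\<lambda>e. clock_increment N h (e, k) \<omega>)" using Suc.prems by simp
  have "p (h * real (Suc k)) = grid_step edge_op E
      (\<lambda>e. N e (h * real (Suc k)) \<omega> - N e (h * real k) \<omega>) (p (h * real k))"
  proof (rule averaging_path_grid_step[where c="\<lambda>e u. N e u \<omega>", OF path mono cont edges])
    show "0 \<le> h * real k" "h * real k \<le> h * real (Suc k)"
      using h by (auto intro: mult_left_mono)
    fix e assume e: "e \<in> E"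
    show "N e (h * real (Suc k)) \<omega> - N e (h * real k) \<omega> \<le> 1"
      using nc e unfolding crowded_def clock_increment_def fst_conv snd_conv
      by (metis One_nat_def Suc_1 not_less_eq_eq)
    fix e' assume "e' \<in> E" "e \<noteq> e'"
    then show "N e (h * real (Suc k)) \<omega> - N e (h * real k) \<omega> = 0 \<or>
        N e' (h * real (Suc k)) \<omega> - N e' (h * real k) \<omega> = 0"
      using nc e unfolding crowded_def clock_increment_def fst_conv snd_conv by (metis neq0_conv)
  qed
  also have "p (h * real k) = grid_chain edge_op E (\<lambda>i. clock_increment N h i \<omega>) (p 0) k"
    using Suc by simp
  finally show ?case by (simp add: clock_increment_def)
qed simp

text \<open>Hides the clocks: what follows uses only these expectations of observables. Bounds on
  \<open>q\<close> are asked for on mass functions alone, since the quadratic observables are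
  unbounded elsewhere.\<close>

lemma averaging_process_grid_approximation:
  fixes t :: real
  assumes proc: "averaging_process M V E \<xi> \<eta>" and fin: "finite V"
    and edges: "\<And>e. e \<in> E \<Longrightarrow> \<exists>x\<in>V. \<exists>y\<in>V. e = {x, y} \<and> x \<noteq> y"
    and t: "0 < t" and K: "0 < K"
  obtains \<zeta> where "\<And>\<omega>. \<zeta> 0 \<omega> = \<xi>" "\<And>k \<omega>. \<zeta> k \<omega> \<in> prob_mass_functions V"
    "\<And>k q. k \<le> K \<Longrightarrow> (\<lambda>\<omega>. q (\<zeta> k \<omega>) :: real) \<in> borel_measurable M"
    "\<And>k q C. k < K \<Longrightarrow> (\<And>s. s \<in> prob_mass_functions V \<Longrightarrow> \<bar>q s\<bar> \<le> C) \<Longrightarrow>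
      prob_space.expectation M (\<lambda>\<omega>. q (\<zeta> (Suc k) \<omega>)) = prob_space.expectation M (\<lambda>\<omega>. q (\<zeta> k \<omega>)) +
        (1 - exp (- t / K)) * exp (- t / K) ^ (card E - 1) *
        prob_space.expectation M (\<lambda>\<omega>. \<Sum>e\<in>E. q (edge_op e (\<zeta> k \<omega>)) - q (\<zeta> k \<omega>))"
    "\<And>q C. (\<lambda>\<omega>. q (\<eta> t \<omega>)) \<in> borel_measurable M \<Longrightarrow>
      (\<And>s. s \<in> prob_mass_functions V \<Longrightarrow> \<bar>q s\<bar> \<le> C) \<Longrightarrow>
      \<bar>prob_space.expectation M (\<lambda>\<omega>. q (\<eta> t \<omega>)) - prob_space.expectation M (\<lambda>\<omega>. q (\<zeta> K \<omega>))\<bar>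
        \<le> 2 * C * ((card E)\<^sup>2 * t\<^sup>2 / K)"
proof -
  let ?S = "prob_mass_functions V"
  interpret prob_space M using proc by (simp add: averaging_process_def)
  have \<xi>: "\<xi> \<in> ?S" using proc by (simp add: averaging_process_def)
  obtain N where clocks: "independent_poisson_clocks M 1 E N"
    and path: "AE \<omega> in M. \<eta> 0 \<omega> = \<xi> \<and> averaging_path E (\<lambda>e t. N e t \<omega>) (\<lambda>t. \<eta> t \<omega>)"
    using proc by (auto simp: averaging_process_def)
  have "E \<subseteq> Pow V" using edges by fastforce
  then have finE: "finite E" using fin by (meson finite_Pow_iff finite_subset)
  have edges': "\<exists>x y. e = {x, y} \<and> x \<noteq> y" if "e \<in> E" for e
    using edges[OF that] by blast
  have op: "edge_op e s \<in> ?S" if "e \<in> E" "s \<in> ?S" for e s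
    using edges[OF that(1)] that(2) fin by (auto simp: edge_op_pair edge_average_prob_mass)
  \<comment> \<open>Chains for all meshes \<open>t / j\<close>, not only \<open>j = K\<close>: the
    others serve to show that \<eta> at time \<open>t\<close> is almost surely a mass
    function.\<close>
  define \<zeta> where "\<zeta> j k \<omega> = grid_chain edge_op E (\<lambda>i. clock_increment N (t / real j) i \<omega>) \<xi> k" for j k \<omega>
  define B where "B j = {\<omega> \<in> space M. \<exists>k<j. crowded E (\<lambda>e. clock_increment N (t / real j) (e, k) \<omega>)}" for j
  define c where "c = (real (card E))\<^sup>2 * t\<^sup>2"
  have \<zeta>_S: "\<zeta> j k \<omega> \<in> ?S" for j k \<omega>
    unfolding \<zeta>_def by (intro grid_chain_invariant \<xi> op)
  have B: "B j \<in> events" "prob (B j) \<le> c / j" if j: "0 < j" for j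
  proof -
    have tj: "0 < t / j" using j t by simp
    show "B j \<in> events"
      unfolding B_def by (rule prob_crowded_le(1)[OF clocks finE _ tj]) simp
    have "prob (B j) \<le> real j * (real (card E))\<^sup>2 * (1 * (t / j))\<^sup>2"
      unfolding B_def by (rule prob_crowded_le(2)[OF clocks finE _ tj]) simp
    also have "\<dots> = c / j"
      using j by (simp add: c_def power2_eq_square)
    finally show "prob (B j) \<le> c / j" .
  qed
  have "AE \<omega> in M. \<forall>e\<in>E. N e 0 \<omega> = 0 \<and> (\<forall>s t. 0 \<le> s \<and> s \<le> t \<longrightarrow> N e s \<omega> \<le> N e t \<omega>) \<and>
        (\<forall>t\<ge>0. continuous (at_right t) (\<lambda>s. N e s \<omega>))"
    using clocks by (intro AE_finite_allI finE) (auto simp: independent_poisson_clocks_def poisson_process_def)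
  with path AE_space have good: "AE \<omega> in M. \<forall>j>0. \<omega> \<notin> B j \<longrightarrow> \<eta> t \<omega> = \<zeta> j j \<omega>"
  proof eventually_elim
    case (elim \<omega>)
    show ?case
    proof (intro allI impI)
      fix j :: nat assume j: "0 < j" "\<omega> \<notin> B j"
      have "\<eta> (t / real j * real j) \<omega> = grid_chain edge_op E (\<lambda>i. clock_increment N (t / real j) i \<omega>) (\<eta> 0 \<omega>) j"
        by (rule averaging_path_grid_chain) (use elim j t edges' in \<open>auto simp: B_def\<close>)
      then show "\<eta> t \<omega> = \<zeta> j j \<omega>" using j elim by (simp add: \<zeta>_def)
    qed
  qed
  \<comment> \<open>The crowding probabilities tend to 0 as the mesh shrinks, so almost surely some
    mesh is not crowded, and there the process agrees with its chain. This confines it to mass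
    functions without a separate treatment of simultaneous rings.\<close>
  have null: "AE \<omega> in M. \<exists>j>0. \<omega> \<notin> B j"
  proof -
    let ?Z = "\<Inter>j\<in>{0<..}. B j"
    have Z: "?Z \<in> events" using B by (intro sets.countable_INT') auto
    have "prob ?Z \<le> c / real j" if "0 < j" for j :: nat
    proof -
      have "prob ?Z \<le> prob (B j)"
        by (rule finite_measure_mono) (use that B in auto)
      also have "\<dots> \<le> c / j" using B that by simp
      finally show ?thesis .
    qed
    then have "eventually (\<lambda>j. prob ?Z \<le> c / real j) sequentially"
      using eventually_gt_at_top[of 0] by (rule eventually_mono[rotated])
    then have "prob ?Z \<le> 0"
      by (rule tendsto_lowerbound[OF lim_const_over_n]) auto
    then have "?Z \<in> null_sets M"
      using Z by (simp add: null_sets_def emeasure_eq_measure measure_le_0_iff)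
    then show ?thesis by (rule AE_I') blast
  qed
  have \<eta>_S: "AE \<omega> in M. \<eta> t \<omega> \<in> ?S"
    using good null
  proof eventually_elim
    case (elim \<omega>)
    then show ?case using \<zeta>_S by metis
  qed
  have h: "0 < t / real K" using t K by simp
  have meas: "(\<lambda>\<omega>. q (\<zeta> K k \<omega>) :: real) \<in> borel_measurable M" for q k
    unfolding \<zeta>_def
    by (rule borel_measurable_grid_chain[where h=q and D="clock_increment N (t / real K)", OF finE])
      (auto intro: measurable_clock_increment[OF clocks less_imp_le[OF h]])
  show ?thesis
  proof (rule that[of "\<zeta> K"])
    show "\<zeta> K 0 \<omega> = \<xi>" for \<omega> by (simp add: \<zeta>_def)
    show "\<zeta> K k \<omega> \<in> ?S" for k \<omega> by (rule \<zeta>_S)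
    show "(\<lambda>\<omega>. q (\<zeta> K k \<omega>) :: real) \<in> borel_measurable M" for q k by (rule meas)
  next
    fix k and q :: "('b \<Rightarrow> real) \<Rightarrow> real" and C assume k: "k < K" and q: "\<And>s. s \<in> ?S \<Longrightarrow> \<bar>q s\<bar> \<le> C"
    have "prob {\<omega> \<in> space M. clock_increment N (t / real K) (e, k) \<omega> = 0} = 1 - (1 - exp (- t / K))"
      if "e \<in> E" for e
      using prob_clock_increment[OF clocks h, of "(e, k)" "{0}"] that poisson_pmf_tails(1)[OF h] by simp
    from expectation_grid_chain_Suc[where f=edge_op and q=q and C=C and S="?S" and s=\<xi>,
        OF finE indep_clock_increments[OF clocks finE less_imp_le[OF h]] this k \<xi> op q]
    show "expectation (\<lambda>\<omega>. q (\<zeta> K (Suc k) \<omega>)) = expectation (\<lambda>\<omega>. q (\<zeta> K k \<omega>)) +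
        (1 - exp (- t / K)) * exp (- t / K) ^ (card E - 1) *
        expectation (\<lambda>\<omega>. \<Sum>e\<in>E. q (edge_op e (\<zeta> K k \<omega>)) - q (\<zeta> K k \<omega>))"
      unfolding \<zeta>_def by simp
  next
    fix q :: "('b \<Rightarrow> real) \<Rightarrow> real" and C assume q_meas: "(\<lambda>\<omega>. q (\<eta> t \<omega>)) \<in> borel_measurable M"
      and q: "\<And>s. s \<in> ?S \<Longrightarrow> \<bar>q s\<bar> \<le> C"
    have C: "0 \<le> C" using q[OF \<xi>] by simp
    have int: "integrable M (\<lambda>\<omega>. q (\<eta> t \<omega>))" "integrable M (\<lambda>\<omega>. q (\<zeta> K K \<omega>))"
    proof -
      show "integrable M (\<lambda>\<omega>. q (\<eta> t \<omega>))"
        using \<eta>_S q by (intro integrable_const_bound[where B=C] q_meas) auto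
      show "integrable M (\<lambda>\<omega>. q (\<zeta> K K \<omega>))"
        using \<zeta>_S q by (intro integrable_const_bound[where B=C] meas) auto
    qed
    have "\<bar>expectation (\<lambda>\<omega>. q (\<eta> t \<omega>)) - expectation (\<lambda>\<omega>. q (\<zeta> K K \<omega>))\<bar>
        = \<bar>expectation (\<lambda>\<omega>. q (\<eta> t \<omega>) - q (\<zeta> K K \<omega>))\<bar>"
      using int by simp
    also have "\<dots> \<le> expectation (\<lambda>\<omega>. \<bar>q (\<eta> t \<omega>) - q (\<zeta> K K \<omega>)\<bar>)"
      by (rule integral_abs_bound)
    \<comment> \<open>Off \<open>B K\<close> the two states agree; on \<open>B K\<close> both are
      mass functions, so the observables differ by at most \<open>2 * C\<close>.\<close>
    also have "\<dots> \<le> expectation (\<lambda>\<omega>. 2 * C * indicator (B K) \<omega>)"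
    proof (rule integral_mono_AE)
      show "integrable M (\<lambda>\<omega>. \<bar>q (\<eta> t \<omega>) - q (\<zeta> K K \<omega>)\<bar>)" using int by simp
      show "integrable M (\<lambda>\<omega>. 2 * C * indicator (B K) \<omega>)"
        using B(1)[OF K] by (simp add: emeasure_eq_measure)
      show "AE \<omega> in M. \<bar>q (\<eta> t \<omega>) - q (\<zeta> K K \<omega>)\<bar> \<le> 2 * C * indicator (B K) \<omega>"
        using good \<eta>_S
      proof eventually_elim
        case (elim \<omega>)
        have "\<bar>q (\<eta> t \<omega>)\<bar> \<le> C" "\<bar>q (\<zeta> K K \<omega>)\<bar> \<le> C" using q elim \<zeta>_S by auto
        then show ?case using elim K by (cases "\<omega> \<in> B K") auto
      qed
    qed
    also have "\<dots> = 2 * C * prob (B K)" using B(1)[OF K] by simp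
    also have "\<dots> \<le> 2 * C * (c / K)" using B(2)[OF K] C by (intro mult_left_mono) auto
    finally show "\<bar>expectation (\<lambda>\<omega>. q (\<eta> t \<omega>)) - expectation (\<lambda>\<omega>. q (\<zeta> K K \<omega>))\<bar>
        \<le> 2 * C * ((card E)\<^sup>2 * t\<^sup>2 / K)" by (simp add: c_def)
  qed
qed

section \<open>Quadratic observables on the complete bipartite graph\<close>

lemma sum_bipartite_edges:
  fixes h :: "nat set \<Rightarrow> real"
  shows "(\<Sum>e\<in>bipartite_edges k l. h e) = (\<Sum>x<k. \<Sum>y\<in>{k..<k + l}. h {x, y})"
proof -
  have "inj_on (\<lambda>(x, y). {x, y}) ({..<k} \<times> {k..<k + l})"
    by (auto simp: inj_on_def doubleton_eq_iff)
  moreover have "bipartite_edges k l = (\<lambda>(x, y). {x, y}) ` ({..<k} \<times> {k..<k + l})"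
    unfolding bipartite_edges_def image_def by fast
  ultimately show ?thesis
    by (simp add: sum.reindex sum.cartesian_product case_prod_unfold)
qed

lemma bipartite_edges_pairs:
  "e \<in> bipartite_edges k l \<Longrightarrow> \<exists>x\<in>bipartite_vertices k l. \<exists>y\<in>bipartite_vertices k l. e = {x, y} \<and> x \<noteq> y"
  by (fastforce simp: bipartite_edges_def bipartite_vertices_def)

lemma sum_bipartite_vertices:
  fixes h :: "nat \<Rightarrow> real"
  shows "(\<Sum>x\<in>bipartite_vertices k l. h x) = (\<Sum>x<k. h x) + (\<Sum>y\<in>{k..<k + l}. h y)"
  unfolding bipartite_vertices_def by (simp add: lessThan_atLeast0 sum.atLeastLessThan_concat)

definition left_energy :: "nat \<Rightarrow> nat \<Rightarrow> (nat \<Rightarrow> real) \<Rightarrow> real" where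
  "left_energy k l \<eta> = (\<Sum>x<k. (\<eta> x - 1 / real (k + l))\<^sup>2)"

definition right_energy :: "nat \<Rightarrow> nat \<Rightarrow> (nat \<Rightarrow> real) \<Rightarrow> real" where
  "right_energy k l \<eta> = (\<Sum>y\<in>{k..<k + l}. (\<eta> y - 1 / real (k + l))\<^sup>2)"

definition imbalance :: "nat \<Rightarrow> nat \<Rightarrow> (nat \<Rightarrow> real) \<Rightarrow> real" where
  "imbalance k l \<eta> = (\<Sum>x<k. \<eta> x - 1 / real (k + l))\<^sup>2"

lemma sum_change_at:
  fixes f g :: "'a \<Rightarrow> real"
  assumes "finite A" "x \<in> A" "\<And>z. z \<in> A \<Longrightarrow> z \<noteq> x \<Longrightarrow> g z = f z"
  shows "sum g A = sum f A + (g x - f x)"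
proof -
  have "sum g (A - {x}) = sum f (A - {x})" using assms by (intro sum.cong) auto
  then show ?thesis using assms by (simp add: sum.remove)
qed

text \<open>The effect of one edge on each of the three observables is a quadratic polynomial in the
  two deviations at its ends; the three generators are read off by matching coefficients, zeros
  included.\<close>

lemma bipartite_double_sum:
  fixes a :: "'a \<Rightarrow> real" and b :: "'b \<Rightarrow> real"
  shows "(\<Sum>x\<in>A. \<Sum>y\<in>B. \<alpha> * (a x)\<^sup>2 + \<beta> * (a x * b y) + \<gamma> * (b y)\<^sup>2 + \<delta> * a x + \<epsilon> * b y)
    = \<alpha> * card B * (\<Sum>x\<in>A. (a x)\<^sup>2) + \<beta> * (sum a A * sum b B) + \<gamma> * card A * (\<Sum>y\<in>B. (b y)\<^sup>2)
      + \<delta> * card B * sum a A + \<epsilon> * card A * sum b B"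
  by (simp add: sum.distrib sum_product flip: sum_distrib_left)

context
  fixes k l :: nat and \<eta> :: "nat \<Rightarrow> real"
  assumes kl: "1 \<le> k" "1 \<le> l" and \<eta>: "\<eta> \<in> prob_mass_functions (bipartite_vertices k l)"
begin

private definition "dev x = \<eta> x - 1 / real (k + l)"

private lemma dev_edge_op:
  assumes "x \<noteq> y"
  shows "edge_op {x, y} \<eta> x - 1 / real (k + l) = (dev x + dev y) / 2"
    "edge_op {x, y} \<eta> y - 1 / real (k + l) = (dev x + dev y) / 2"
    "z \<noteq> x \<Longrightarrow> z \<noteq> y \<Longrightarrow> edge_op {x, y} \<eta> z - 1 / real (k + l) = dev z"
proof -
  define c where "c = 1 / real (k + l)"
  show "edge_op {x, y} \<eta> x - 1 / real (k + l) = (dev x + dev y) / 2"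
    "edge_op {x, y} \<eta> y - 1 / real (k + l) = (dev x + dev y) / 2"
    "z \<noteq> x \<Longrightarrow> z \<noteq> y \<Longrightarrow> edge_op {x, y} \<eta> z - 1 / real (k + l) = dev z"
    using assms unfolding dev_def c_def[symmetric] edge_op_pair[OF assms] edge_average_def
    by (auto simp: field_simps)
qed

text \<open>Turns the product of the two part sums into minus the square of one of them, which
  closes the system of three observables.\<close>

private lemma total_dev: "sum dev {k..<k + l} = - sum dev {..<k}"
proof -
  have "(\<Sum>x<k. \<eta> x) + (\<Sum>y\<in>{k..<k + l}. \<eta> y) = 1"
    using \<eta> by (simp add: prob_mass_functions_def sum_bipartite_vertices)
  moreover have "sum dev {..<k} = (\<Sum>x<k. \<eta> x) - k / real (k + l)"
    "sum dev {k..<k + l} = (\<Sum>y\<in>{k..<k + l}. \<eta> y) - l / real (k + l)"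
    by (simp_all add: dev_def[abs_def] sum_subtractf)
  moreover have "k / real (k + l) + l / real (k + l) = 1"
    using kl by (simp flip: add_divide_distrib)
  ultimately show ?thesis by linarith
qed

private lemma energies: "left_energy k l \<eta> = (\<Sum>x<k. (dev x)\<^sup>2)"
  "right_energy k l \<eta> = (\<Sum>y\<in>{k..<k + l}. (dev y)\<^sup>2)"
  "imbalance k l \<eta> = (sum dev {..<k})\<^sup>2"
  by (simp_all add: left_energy_def right_energy_def imbalance_def dev_def)

text \<open>The imbalance comes from the cross term \<open>1 / 2 * (dev x * dev y)\<close>: summed
  over all edges it is half the product of the two part sums. The same happens for the right
  energy.\<close>

lemma generator_left_energy:
  "(\<Sum>e\<in>bipartite_edges k l. left_energy k l (edge_op e \<eta>) - left_energy k l \<eta>)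
    = - (3 / 4) * l * left_energy k l \<eta> + k / 4 * right_energy k l \<eta> - imbalance k l \<eta> / 2"
proof -
  have "left_energy k l (edge_op {x, y} \<eta>) - left_energy k l \<eta>
      = - (3 / 4) * (dev x)\<^sup>2 + 1 / 2 * (dev x * dev y) + 1 / 4 * (dev y)\<^sup>2 + 0 * dev x + 0 * dev y"
    if "x \<in> {..<k}" "y \<in> {k..<k + l}" for x y
  proof -
    have xy: "x \<noteq> y" using that by auto
    have "left_energy k l (edge_op {x, y} \<eta>) = left_energy k l \<eta> + (((dev x + dev y) / 2)\<^sup>2 - (dev x)\<^sup>2)"
      unfolding energies unfolding left_energy_def using that
      by (subst sum_change_at[where x=x and f="\<lambda>x. (dev x)\<^sup>2"]) (auto simp: dev_edge_op[OF xy] simp del: of_nat_add)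
    then show ?thesis by (simp add: power2_eq_square field_simps)
  qed
  then have "(\<Sum>e\<in>bipartite_edges k l. left_energy k l (edge_op e \<eta>) - left_energy k l \<eta>)
      = (\<Sum>x<k. \<Sum>y\<in>{k..<k + l}.
        - (3 / 4) * (dev x)\<^sup>2 + 1 / 2 * (dev x * dev y) + 1 / 4 * (dev y)\<^sup>2 + 0 * dev x + 0 * dev y)"
    by (simp only: sum_bipartite_edges cong: sum.cong)
  then show ?thesis
    unfolding bipartite_double_sum by (simp add: energies total_dev power2_eq_square)
qed

lemma generator_right_energy:
  "(\<Sum>e\<in>bipartite_edges k l. right_energy k l (edge_op e \<eta>) - right_energy k l \<eta>)
    = l / 4 * left_energy k l \<eta> - 3 / 4 * k * right_energy k l \<eta> - imbalance k l \<eta> / 2"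
proof -
  have "right_energy k l (edge_op {x, y} \<eta>) - right_energy k l \<eta>
      = 1 / 4 * (dev x)\<^sup>2 + 1 / 2 * (dev x * dev y) + - (3 / 4) * (dev y)\<^sup>2 + 0 * dev x + 0 * dev y"
    if "x \<in> {..<k}" "y \<in> {k..<k + l}" for x y
  proof -
    have xy: "x \<noteq> y" using that by auto
    have "right_energy k l (edge_op {x, y} \<eta>) = right_energy k l \<eta> + (((dev x + dev y) / 2)\<^sup>2 - (dev y)\<^sup>2)"
      unfolding energies unfolding right_energy_def using that
      by (subst sum_change_at[where x=y and f="\<lambda>x. (dev x)\<^sup>2"]) (auto simp: dev_edge_op[OF xy] simp del: of_nat_add)
    then show ?thesis by (simp add: power2_eq_square field_simps)
  qed
  then have "(\<Sum>e\<in>bipartite_edges k l. right_energy k l (edge_op e \<eta>) - right_energy k l \<eta>)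
      = (\<Sum>x<k. \<Sum>y\<in>{k..<k + l}.
        1 / 4 * (dev x)\<^sup>2 + 1 / 2 * (dev x * dev y) + - (3 / 4) * (dev y)\<^sup>2 + 0 * dev x + 0 * dev y)"
    by (simp only: sum_bipartite_edges cong: sum.cong)
  then show ?thesis
    unfolding bipartite_double_sum by (simp add: energies total_dev power2_eq_square)
qed

text \<open>An edge moves the sum \<open>P\<close> over the first part by
  \<open>(dev y - dev x) / 2\<close>, so \<open>P\<^sup>2\<close> changes by
  \<open>P * (dev y - dev x) + (dev y - dev x)\<^sup>2 / 4\<close>. The linear terms give the
  damping \<open>k + l\<close>, of which the cross term takes back \<open>1 / 2\<close>.\<close>

lemma generator_imbalance:
  "(\<Sum>e\<in>bipartite_edges k l. imbalance k l (edge_op e \<eta>) - imbalance k l \<eta>)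
    = l / 4 * left_energy k l \<eta> + k / 4 * right_energy k l \<eta> - (k + l - 1 / 2) * imbalance k l \<eta>"
proof -
  let ?P = "sum dev {..<k}"
  have "imbalance k l (edge_op {x, y} \<eta>) - imbalance k l \<eta>
      = 1 / 4 * (dev x)\<^sup>2 + - (1 / 2) * (dev x * dev y) + 1 / 4 * (dev y)\<^sup>2 + - ?P * dev x + ?P * dev y"
    if xy: "x \<in> {..<k}" "y \<in> {k..<k + l}" for x y
  proof -
    have P': "(\<Sum>z<k. edge_op {x, y} \<eta> z - 1 / real (k + l)) = ?P + (dev y - dev x) / 2"
    proof -
      have ne: "x \<noteq> y" using xy by auto
      have "(\<Sum>z<k. edge_op {x, y} \<eta> z - 1 / real (k + l)) = ?P + ((dev x + dev y) / 2 - dev x)"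
        using xy by (subst sum_change_at[where x=x and f=dev]) (auto simp: dev_edge_op[OF ne] simp del: of_nat_add)
      then show ?thesis by (simp add: field_simps)
    qed
    then show ?thesis
      unfolding energies imbalance_def[of k l "edge_op {x, y} \<eta>"] P' by (simp add: power2_eq_square field_simps)
  qed
  then have "(\<Sum>e\<in>bipartite_edges k l. imbalance k l (edge_op e \<eta>) - imbalance k l \<eta>)
      = (\<Sum>x<k. \<Sum>y\<in>{k..<k + l}.
        1 / 4 * (dev x)\<^sup>2 + - (1 / 2) * (dev x * dev y) + 1 / 4 * (dev y)\<^sup>2 + - ?P * dev x + ?P * dev y)"
    by (simp only: sum_bipartite_edges cong: sum.cong)
  then show ?thesis
    unfolding bipartite_double_sum by (simp add: energies total_dev power2_eq_square algebra_simps)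
qed

text \<open>Used for integrability and for the initial values of the recursion. The total energy is
  the sum of the squares of \<eta> minus \<open>1 / n\<close>, and the imbalance is the squared
  difference of two numbers in [0, 1].\<close>

lemma energies_bounds:
  "0 \<le> left_energy k l \<eta>" "0 \<le> right_energy k l \<eta>" "0 \<le> imbalance k l \<eta>"
  "left_energy k l \<eta> + right_energy k l \<eta> \<le> 1" "imbalance k l \<eta> \<le> 1"
proof -
  let ?V = "bipartite_vertices k l"
  show "0 \<le> left_energy k l \<eta>" "0 \<le> right_energy k l \<eta>" "0 \<le> imbalance k l \<eta>"
    by (auto simp: energies intro: sum_nonneg)
  have pos: "0 \<le> \<eta> x" if "x \<in> ?V" for x using \<eta> that by (simp add: prob_mass_functions_def)
  have tot: "(\<Sum>x\<in>?V. \<eta> x) = 1" using \<eta> by (simp add: prob_mass_functions_def)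
  have fin: "finite ?V" by (simp add: bipartite_vertices_def)
  have le1: "\<eta> x \<le> 1" if "x \<in> ?V" for x
    using member_le_sum[of x ?V \<eta>] that pos fin tot by simp
  have sq: "(\<Sum>x\<in>?V. (\<eta> x)\<^sup>2) \<le> 1"
  proof -
    have "(\<Sum>x\<in>?V. (\<eta> x)\<^sup>2) \<le> (\<Sum>x\<in>?V. \<eta> x)"
      using pos le1 by (intro sum_mono) (simp add: power2_eq_square mult_left_le)
    then show ?thesis using tot by simp
  qed
  have "left_energy k l \<eta> + right_energy k l \<eta> = (\<Sum>x\<in>?V. (\<eta> x - 1 / real (k + l))\<^sup>2)"
    by (simp add: left_energy_def right_energy_def sum_bipartite_vertices)
  also have "\<dots> = (\<Sum>x\<in>?V. (\<eta> x)\<^sup>2) - 2 / real (k + l) * (\<Sum>x\<in>?V. \<eta> x) + (\<Sum>x\<in>?V. (1 / real (k + l))\<^sup>2)"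
    by (simp add: power2_diff sum.distrib sum_subtractf sum_distrib_left sum_divide_distrib mult_ac)
  also have "(\<Sum>x\<in>?V. (1 / real (k + l))\<^sup>2) = 1 / real (k + l)"
    using kl by (simp add: bipartite_vertices_def power2_eq_square)
  finally have "left_energy k l \<eta> + right_energy k l \<eta> = (\<Sum>x\<in>?V. (\<eta> x)\<^sup>2) - 1 / real (k + l)"
    by (simp add: tot)
  moreover have "0 \<le> 1 / real (k + l)" by simp
  ultimately show "left_energy k l \<eta> + right_energy k l \<eta> \<le> 1" using sq by linarith
  have "sum dev {..<k} = (\<Sum>x<k. \<eta> x) - k / real (k + l)"
    by (simp add: dev_def[abs_def] sum_subtractf)
  moreover have "0 \<le> (\<Sum>x<k. \<eta> x)" "0 \<le> (\<Sum>y\<in>{k..<k + l}. \<eta> y)"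
    using pos by (auto intro!: sum_nonneg simp: bipartite_vertices_def)
  moreover have "(\<Sum>x<k. \<eta> x) + (\<Sum>y\<in>{k..<k + l}. \<eta> y) = 1"
    using tot by (simp add: sum_bipartite_vertices)
  moreover have "0 \<le> k / real (k + l)" "k / real (k + l) \<le> 1" using kl by (auto simp: field_simps)
  ultimately have "\<bar>sum dev {..<k}\<bar> \<le> 1" by linarith
  then show "imbalance k l \<eta> \<le> 1" by (simp add: energies abs_square_le_1)
qed

end

section \<open>The linear recursion\<close>

text \<open>
  Without the terms in \<open>z\<close>, the recursion below for \<open>(x, y)\<close> has the decay rates \<open>lam\<close> and \<open>lam2\<close>,
  the roots of the quadratic assumed in \<open>characteristic\<close>. The corresponding left eigenvectors are
  \<open>(1, v)\<close> and \<open>(1, - \<kappa>)\<close>.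
\<close>

locale energy_constants =
  fixes m l n lam lam2 v \<kappa> :: real
  assumes m: "1 \<le> m" "m \<le> l" and n: "n = m + l"
    and characteristic: "4 * lam\<^sup>2 - 3 * n * lam + 2 * m * l = 0"
    and lam: "m / 2 \<le> lam" "lam \<le> 3 / 4 * m" "lam \<le> l / 2" "lam \<le> n / 4"
    and lam2: "lam2 = 3 / 4 * n - lam"
    and v: "v * l = 3 * l - 4 * lam" and \<kappa>: "\<kappa> * l = 3 * m - 4 * lam"
begin

text \<open>Each bound on \<open>lam\<close> has its purpose: \<open>lam \<le> l / 2\<close> gives
  \<open>1 \<le> v\<close>, \<open>lam \<le> 3 / 4 * m\<close> gives
  \<open>0 \<le> \<kappa>\<close>, \<open>m / 2 \<le> lam\<close> gives
  \<open>\<kappa> \<le> 1\<close>, and \<open>lam \<le> n / 4\<close> gives the gap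
  \<open>n / 4\<close> between the two rates.\<close>

lemma bounds: "1 \<le> v" "v \<le> 3" "0 \<le> \<kappa>" "\<kappa> \<le> 1" "2 \<le> n" "0 < l" "0 < lam" "lam2 \<le> 3 / 4 * n"
    "lam + n / 4 \<le> lam2"
proof -
  show l: "0 < l" and lp: "0 < lam" and "2 \<le> n" using m lam n by auto
  show "lam2 \<le> 3 / 4 * n" "lam + n / 4 \<le> lam2" using lam2 lp lam by auto
  have "1 * l \<le> v * l" "v * l \<le> 3 * l" "0 * l \<le> \<kappa> * l" "\<kappa> * l \<le> 1 * l"
    unfolding v \<kappa> using lam lp m by linarith+
  then show "1 \<le> v" "v \<le> 3" "0 \<le> \<kappa>" "\<kappa> \<le> 1" using l by (auto simp: zero_le_mult_iff)
qed

text \<open>The assumption \<open>v\<close> is the first component of the eigenvector equation and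
  this is the second; multiplied by \<open>l\<close> it becomes the characteristic equation. The
  fast mode is treated likewise.\<close>

lemma left_eigenvector_slow: "m / 4 - 3 / 4 * m * v = - (lam * v)"
proof -
  have "(m / 4 - 3 / 4 * m * v + lam * v) * l = m * l / 4 - 3 / 4 * m * (v * l) + lam * (v * l)"
    by (simp add: algebra_simps)
  also have "\<dots> = 0" unfolding v using characteristic n by (simp add: algebra_simps power2_eq_square)
  finally show ?thesis using bounds by auto
qed

lemma left_eigenvector_fast: "m / 4 + 3 / 4 * m * \<kappa> = lam2 * \<kappa>"
proof -
  have "(m / 4 + 3 / 4 * m * \<kappa> - lam2 * \<kappa>) * l = m * l / 4 + 3 / 4 * m * (\<kappa> * l) - lam2 * (\<kappa> * l)"
    by (simp add: algebra_simps)
  also have "\<dots> = 0" unfolding \<kappa> lam2 using characteristic n by (simp add: field_simps power2_eq_square)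
  finally show ?thesis using bounds by auto
qed

end

locale energy_recursion = energy_constants +
  fixes \<rho> :: real and x y z :: "nat \<Rightarrow> real" and K :: nat
  assumes rho: "0 \<le> \<rho>" "\<rho> * n \<le> 1 / 2"
    and x_Suc: "\<And>k. k < K \<Longrightarrow> x (Suc k) = x k + \<rho> * (- (3 / 4) * l * x k + m / 4 * y k - z k / 2)"
    and y_Suc: "\<And>k. k < K \<Longrightarrow> y (Suc k) = y k + \<rho> * (l / 4 * x k - 3 / 4 * m * y k - z k / 2)"
    and z_Suc: "\<And>k. k < K \<Longrightarrow> z (Suc k) = z k + \<rho> * (l / 4 * x k + m / 4 * y k - (n - 1 / 2) * z k)"
    and nonneg: "\<And>k. k \<le> K \<Longrightarrow> 0 \<le> x k" "\<And>k. k \<le> K \<Longrightarrow> 0 \<le> y k" "\<And>k. k \<le> K \<Longrightarrow> 0 \<le> z k"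
    and init: "x 0 + y 0 \<le> 1" "z 0 \<le> 1"
begin

definition "\<phi> k = x k + v * y k"
definition "\<psi> k = x k - \<kappa> * y k"
definition "r = 1 - \<rho> * lam"
definition "q = 1 - \<rho> * lam2"

text \<open>Nonnegative one-step factors let inequalities be iterated. The bound
  \<open>1 / 2 \<le> r\<close> allows \<open>r ^ k\<close> to be replaced by
  \<open>2 * r ^ Suc k\<close>.\<close>

lemma rates: "1 / 2 \<le> r" "r \<le> 1" "0 \<le> q"
proof -
  have "\<rho> * lam \<le> \<rho> * n" "\<rho> * lam2 \<le> \<rho> * n" "0 \<le> \<rho> * lam"
    using rho lam bounds by (auto intro!: mult_left_mono)
  then show "1 / 2 \<le> r" "r \<le> 1" "0 \<le> q" using rho by (auto simp: r_def q_def)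
qed

lemma \<phi>_Suc: "k < K \<Longrightarrow> \<phi> (Suc k) = r * \<phi> k - \<rho> * (1 + v) / 2 * z k"
proof -
  assume k: "k < K"
  have "\<phi> (Suc k) = \<phi> k + \<rho> * ((- (3 / 4) * l + v * l / 4) * x k + (m / 4 - 3 / 4 * m * v) * y k - (1 + v) / 2 * z k)"
    using k by (simp add: \<phi>_def x_Suc y_Suc algebra_simps)
  also have "- (3 / 4) * l + v * l / 4 = - lam" using v by linarith
  finally show ?thesis unfolding left_eigenvector_slow by (simp add: \<phi>_def r_def algebra_simps)
qed

lemma \<psi>_Suc: "k < K \<Longrightarrow> \<psi> (Suc k) = q * \<psi> k - \<rho> * (1 - \<kappa>) / 2 * z k"
proof -
  assume k: "k < K"
  have "\<psi> (Suc k) = \<psi> k + \<rho> * ((- (3 / 4) * l - \<kappa> * l / 4) * x k + (m / 4 + 3 / 4 * m * \<kappa>) * y k - (1 - \<kappa>) / 2 * z k)"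
    using k by (simp add: \<psi>_def x_Suc y_Suc field_simps)
  also have "- (3 / 4) * l - \<kappa> * l / 4 = - lam2" using \<kappa> lam2 n by linarith
  finally show ?thesis unfolding left_eigenvector_fast by (simp add: \<psi>_def q_def algebra_simps)
qed

lemma \<phi>_upper: "k \<le> K \<Longrightarrow> \<phi> k \<le> r ^ k * \<phi> 0"
proof (induction k)
  case (Suc k)
  have "\<phi> (Suc k) \<le> r * \<phi> k"
    using \<phi>_Suc[of k] Suc.prems rho bounds nonneg(3)[of k] by simp
  also have "\<dots> \<le> r * (r ^ k * \<phi> 0)" using Suc rates by (intro mult_left_mono) auto
  finally show ?case by simp
qed simp

lemma \<psi>_upper: "k \<le> K \<Longrightarrow> \<psi> k \<le> q ^ k * \<psi> 0"
proof (induction k)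
  case (Suc k)
  have "\<psi> (Suc k) \<le> q * \<psi> k"
    using \<psi>_Suc[of k] Suc.prems rho bounds nonneg(3)[of k] by simp
  also have "\<dots> \<le> q * (q ^ k * \<psi> 0)" using Suc rates by (intro mult_left_mono) auto
  finally show ?case by simp
qed simp

text \<open>As \<open>1 \<le> v\<close>, the slow mode weighs \<open>y\<close> most; the bound is
  approached when nearly all energy sits in the larger part.\<close>

lemma \<phi>_0: "\<phi> 0 \<le> v"
proof -
  have "x 0 \<le> v * x 0" using bounds nonneg(1)[of 0] by (simp add: mult_le_cancel_right1)
  then have "\<phi> 0 \<le> v * (x 0 + y 0)" by (simp add: \<phi>_def algebra_simps)
  also have "\<dots> \<le> v" using init bounds by (simp add: mult_left_le)
  finally show ?thesis .
qed

lemma \<psi>_0: "\<bar>\<psi> 0\<bar> \<le> 1"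
proof -
  have "\<kappa> * y 0 \<le> 1 * 1" using bounds nonneg(1,2)[of 0] init by (intro mult_mono) auto
  moreover have "0 \<le> \<kappa> * y 0" using bounds nonneg(2)[of 0] by simp
  ultimately show ?thesis using nonneg(1,2)[of 0] init by (auto simp: \<psi>_def)
qed

lemma \<phi>_le: "k \<le> K \<Longrightarrow> \<phi> k \<le> 3 * r ^ k"
proof -
  assume "k \<le> K"
  then have "\<phi> k \<le> r ^ k * \<phi> 0" by (rule \<phi>_upper)
  also have "\<dots> \<le> r ^ k * 3" using \<phi>_0 bounds rates by (intro mult_left_mono) auto
  finally show ?thesis by simp
qed

lemma xy_le_\<phi>: "k \<le> K \<Longrightarrow> x k + y k \<le> \<phi> k"
  using bounds nonneg(2)[of k] by (simp add: \<phi>_def mult_le_cancel_right1)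

text \<open>\<open>z\<close> is fed by \<open>x + y\<close> at rate at most \<open>n / 4\<close> and
  damped at rate \<open>n - 1 / 2\<close>. The net rate \<open>3 / 4 * n - 1 / 2\<close> is at least
  \<open>lam\<close>, so \<open>z\<close> inherits the bound for \<phi>.\<close>

lemma z_upper: "k \<le> K \<Longrightarrow> z k \<le> 3 * r ^ k"
proof (induction k)
  case 0
  then show ?case using init by simp
next
  case (Suc k)
  have k: "k \<le> K" "k < K" using Suc.prems by auto
  have "l / 4 * x k + m / 4 * y k \<le> n / 4 * x k + n / 4 * y k"
    using n m bounds nonneg(1,2)[OF k(1)] by (intro add_mono mult_right_mono) auto
  also have "\<dots> = n / 4 * (x k + y k)" by (simp add: algebra_simps)
  also have "\<dots> \<le> n / 4 * (3 * r ^ k)"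
    using xy_le_\<phi>[OF k(1)] \<phi>_le[OF k(1)] bounds by (intro mult_left_mono) auto
  finally have "\<rho> * (l / 4 * x k + m / 4 * y k) \<le> \<rho> * (n / 4 * (3 * r ^ k))"
    using rho by (intro mult_left_mono) auto
  moreover have "(1 - \<rho> * (n - 1 / 2)) * z k \<le> (1 - \<rho> * (n - 1 / 2)) * (3 * r ^ k)"
    using Suc.IH[OF k(1)] rho by (intro mult_left_mono) (auto simp: algebra_simps)
  ultimately have "z (Suc k) \<le> (1 - \<rho> * (3 / 4 * n - 1 / 2)) * (3 * r ^ k)"
    using z_Suc[OF k(2)] by (simp add: algebra_simps)
  also have "\<dots> \<le> r * (3 * r ^ k)"
  proof (rule mult_right_mono)
    have "\<rho> * lam \<le> \<rho> * (3 / 4 * n - 1 / 2)" using rho lam bounds by (intro mult_left_mono) auto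
    then show "1 - \<rho> * (3 / 4 * n - 1 / 2) \<le> r" by (simp add: r_def)
  qed (use rates in auto)
  finally show ?case by simp
qed

text \<open>The forcing by \<open>z\<close> is at most \<open>\<rho> * 3 / 2 * r ^ k\<close>, and
  \<open>r - q\<close> is at least \<open>\<rho> * n / 4\<close>. A term \<open>c * r ^ k\<close>
  absorbs the forcing once \<open>c * n / 4\<close> reaches \<open>3 / 2\<close>, hence
  \<open>6 / n\<close>.\<close>

lemma \<psi>_lower: "k \<le> K \<Longrightarrow> - (q ^ k) - 6 / n * r ^ k \<le> \<psi> k"
proof (induction k)
  case 0
  have "0 \<le> 6 / n" using bounds by simp
  moreover have "- 1 \<le> \<psi> 0" using \<psi>_0 by linarith
  ultimately show ?case unfolding power_0 by linarith
next
  case (Suc k)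
  have k: "k \<le> K" "k < K" using Suc.prems by auto
  have "(1 - \<kappa>) / 2 * z k \<le> 1 / 2 * (3 * r ^ k)"
    using bounds z_upper[OF k(1)] nonneg(3)[OF k(1)] by (intro mult_mono) auto
  then have 1: "\<rho> * ((1 - \<kappa>) / 2 * z k) \<le> \<rho> * (1 / 2 * (3 * r ^ k))" using rho by (intro mult_left_mono) auto
  have 2: "q * (- (q ^ k) - 6 / n * r ^ k) \<le> q * \<psi> k"
    using Suc.IH[OF k(1)] rates by (intro mult_left_mono) auto
  have "\<rho> * (n / 4) \<le> \<rho> * (lam2 - lam)" using bounds rho by (intro mult_left_mono) auto
  then have "r - q \<ge> \<rho> * n / 4" by (simp add: r_def q_def algebra_simps)
  then have "(\<rho> * n / 4) * (6 / n * r ^ k) \<le> (r - q) * (6 / n * r ^ k)"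
    using bounds rates by (intro mult_right_mono) auto
  then have 3: "\<rho> * (1 / 2 * (3 * r ^ k)) \<le> (r - q) * (6 / n * r ^ k)" using bounds by simp
  have "\<psi> (Suc k) = q * \<psi> k - \<rho> * ((1 - \<kappa>) / 2 * z k)" using \<psi>_Suc[OF k(2)] by simp
  moreover have "- (q ^ Suc k) - 6 / n * r ^ Suc k = q * (- (q ^ k) - 6 / n * r ^ k) - (r - q) * (6 / n * r ^ k)"
    by (simp add: algebra_simps add_divide_distrib diff_divide_distrib)
  ultimately show ?case using 1 2 3 by linarith
qed

text \<open>The correction makes the contribution of \<open>z\<close> to the increment nonnegative. What is lost instead is
  of order \<open>lam / n\<close> per unit of time, which is negligible at times of order \<open>ln n / lam\<close>.\<close>

definition "\<omega> k = \<phi> k - 3 / n * (z k + x k)"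

text \<open>With \<open>\<epsilon> = 3 / n\<close> the correction adds
  \<open>\<epsilon> * (n - lam) \<ge> 9 / 4\<close> to the coefficient of \<open>z\<close>, against
  a loss of \<open>(1 + v) / 2 \<le> 2\<close>. A multiple of \<open>z\<close> alone would leave the
  negative term \<open>- \<epsilon> * l / 4 * x\<close>; including \<open>x\<close> turns its
  coefficient into \<open>\<epsilon> * (l / 2 - lam) \<ge> 0\<close>. What is lost is
  \<open>\<epsilon> * m / 2 * y\<close>, and \<open>m \<le> 2 * lam\<close> makes this of order
  \<open>lam / n\<close>.\<close>

lemma \<omega>_lower: "k \<le> K \<Longrightarrow> r ^ k * (\<omega> 0 - k * (18 * \<rho> * lam / n)) \<le> \<omega> k"
proof (induction k)
  case (Suc k)
  have k: "k \<le> K" "k < K" using Suc.prems by auto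
  define \<epsilon> where "\<epsilon> = 3 / n"
  have n0: "0 < n" using bounds by simp
  have \<epsilon>: "0 < \<epsilon>" "\<epsilon> * n = 3" using n0 by (simp_all add: \<epsilon>_def)
  have xz: "0 \<le> x k" "0 \<le> z k" "0 \<le> y k" using nonneg k by auto
  have zc: "0 \<le> (- (1 + v) / 2 + \<epsilon> * n - \<epsilon> * lam) * z k"
  proof (rule mult_nonneg_nonneg[OF _ xz(2)])
    have "\<epsilon> * lam \<le> \<epsilon> * (n / 4)" using lam \<epsilon> by (intro mult_left_mono) auto
    then have "\<epsilon> * lam \<le> 3 / 4" using \<epsilon>(2) by simp
    moreover have "0 \<le> - (1 + v) / 2 + 3 - w" if "w \<le> 3 / 4" for w :: real
      using that bounds(2) by (simp add: field_simps)
    ultimately show "0 \<le> - (1 + v) / 2 + \<epsilon> * n - \<epsilon> * lam"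
      unfolding \<epsilon>(2) by blast
  qed
  have xc: "0 \<le> \<epsilon> * (l / 2 - lam) * x k" using lam \<epsilon> xz by simp
  have "\<omega> (Suc k) - r * \<omega> k + \<rho> * (\<epsilon> * m / 2 * y k)
      = \<rho> * ((- (1 + v) / 2 + \<epsilon> * n - \<epsilon> * lam) * z k + \<epsilon> * (l / 2 - lam) * x k)"
    unfolding \<omega>_def \<epsilon>_def[symmetric] \<phi>_Suc[OF k(2)] x_Suc[OF k(2)] z_Suc[OF k(2)] r_def
    by (simp add: algebra_simps add_divide_distrib diff_divide_distrib)
  also have "0 \<le> \<dots>" using rho xc zc by simp
  finally have step: "r * \<omega> k - \<rho> * (\<epsilon> * m / 2 * y k) \<le> \<omega> (Suc k)" by simp
  have "m * y k \<le> (2 * lam) * \<phi> k"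
    using xy_le_\<phi>[OF k(1)] xz lam bounds m by (intro mult_mono) auto
  also have "\<dots> \<le> (2 * lam) * (3 * r ^ k)" using \<phi>_le[OF k(1)] bounds by (intro mult_left_mono) auto
  also have "\<dots> \<le> (2 * lam) * (3 * (2 * r ^ Suc k))" using rates bounds by (intro mult_left_mono) auto
  finally have "\<rho> * \<epsilon> / 2 * (m * y k) \<le> \<rho> * \<epsilon> / 2 * ((2 * lam) * (3 * (2 * r ^ Suc k)))"
    using rho \<epsilon> by (intro mult_left_mono) auto
  also have "\<dots> = r ^ Suc k * (18 * \<rho> * lam / n)" by (simp add: \<epsilon>_def field_simps)
  finally have loss: "\<rho> * (\<epsilon> * m / 2 * y k) \<le> r ^ Suc k * (18 * \<rho> * lam / n)" by (simp add: algebra_simps)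
  have "r * (r ^ k * (\<omega> 0 - k * (18 * \<rho> * lam / n))) \<le> r * \<omega> k"
    using Suc.IH[OF k(1)] rates by (intro mult_left_mono) auto
  moreover have "r ^ Suc k * (\<omega> 0 - real (Suc k) * c) = r * (r ^ k * (\<omega> 0 - k * c)) - r ^ Suc k * c" for c :: real
    by (simp add: algebra_simps)
  note this[of "18 * \<rho> * lam / n"]
  ultimately show ?case using step loss by linarith
qed simp

section \<open>The total energy recovered from the two modes\<close>

lemma xy_eq: "x k + y k = (1 + \<kappa>) / (v + \<kappa>) * \<phi> k + (v - 1) / (v + \<kappa>) * \<psi> k"
proof -
  have "v + \<kappa> \<noteq> 0" using bounds by auto
  moreover have "(v + \<kappa>) * (x k + y k) = (1 + \<kappa>) * \<phi> k + (v - 1) * \<psi> k"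
    by (simp add: \<phi>_def \<psi>_def algebra_simps)
  ultimately have "x k + y k = ((1 + \<kappa>) * \<phi> k + (v - 1) * \<psi> k) / (v + \<kappa>)"
    by (metis nonzero_mult_div_cancel_left)
  then show ?thesis by (simp only: add_divide_distrib[of "(1 + \<kappa>) * \<phi> k"] times_divide_eq_left)
qed

lemma weights: "0 \<le> (1 + \<kappa>) / (v + \<kappa>)" "0 \<le> (v - 1) / (v + \<kappa>)" "(v - 1) / (v + \<kappa>) \<le> 1"
  using bounds by (auto simp: field_simps)

lemma energy_upper: "x K + y K \<le> (1 + \<kappa>) / (v + \<kappa>) * v * r ^ K + q ^ K"
proof -
  have "\<phi> K \<le> r ^ K * \<phi> 0" by (rule \<phi>_upper) simp
  also have "\<dots> \<le> r ^ K * v" using \<phi>_0 rates by (intro mult_left_mono) auto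
  finally have "\<phi> K \<le> r ^ K * v" .
  then have 1: "(1 + \<kappa>) / (v + \<kappa>) * \<phi> K \<le> (1 + \<kappa>) / (v + \<kappa>) * (r ^ K * v)"
    using weights by (intro mult_left_mono) auto
  have q: "0 \<le> q ^ K" using rates by simp
  have "\<psi> K \<le> q ^ K * \<psi> 0" by (rule \<psi>_upper) simp
  also have "\<dots> \<le> q ^ K * 1" using \<psi>_0 q by (intro mult_left_mono) auto
  finally have "(v - 1) / (v + \<kappa>) * \<psi> K \<le> (v - 1) / (v + \<kappa>) * (q ^ K * 1)"
    using weights by (intro mult_left_mono) auto
  also have "\<dots> \<le> 1 * (q ^ K * 1)" using weights q by (intro mult_right_mono) auto
  finally show ?thesis using 1 by (simp add: xy_eq algebra_simps)
qed

text \<open>The inner \<open>6 / n\<close> bounds the correction in \<omega> at the start, the term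
  with \<open>K\<close> is the loss accumulated in \<open>\<omega>_lower\<close>, and the last two
  terms come from \<open>\<psi>_lower\<close>.\<close>

lemma energy_lower:
  "(1 + \<kappa>) / (v + \<kappa>) * (r ^ K * (v * y 0 - 6 / n - K * (18 * \<rho> * lam / n))) - q ^ K - 6 / n * r ^ K \<le> x K + y K"
proof -
  have n0: "0 < n" using bounds by simp
  have "3 / n * (z 0 + x 0) \<le> 3 / n * 2"
    using init nonneg(2)[of 0] n0 by (intro mult_left_mono) auto
  then have "v * y 0 - 6 / n \<le> \<omega> 0"
    using nonneg(1)[of 0] by (simp add: \<omega>_def \<phi>_def)
  then have "r ^ K * (v * y 0 - 6 / n - K * (18 * \<rho> * lam / n)) \<le> r ^ K * (\<omega> 0 - K * (18 * \<rho> * lam / n))"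
    using rates by (intro mult_left_mono) auto
  also have "\<dots> \<le> \<omega> K" by (rule \<omega>_lower) simp
  also have "\<dots> \<le> \<phi> K" using nonneg(1,3)[of K] n0 by (simp add: \<omega>_def)
  finally have 1: "(1 + \<kappa>) / (v + \<kappa>) * (r ^ K * (v * y 0 - 6 / n - K * (18 * \<rho> * lam / n)))
      \<le> (1 + \<kappa>) / (v + \<kappa>) * \<phi> K"
    using weights by (intro mult_left_mono) auto
  have e: "0 \<le> q ^ K + 6 / n * r ^ K" using rates n0 by simp
  have 2: "(v - 1) / (v + \<kappa>) * (q ^ K + 6 / n * r ^ K) \<le> 1 * (q ^ K + 6 / n * r ^ K)"
    using weights e by (intro mult_right_mono) auto
  have 3: "(v - 1) / (v + \<kappa>) * (- (q ^ K) - 6 / n * r ^ K) \<le> (v - 1) / (v + \<kappa>) * \<psi> K"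
    using weights \<psi>_lower[of K] by (intro mult_left_mono) auto
  have "a - b - c \<le> a' + w * d" if "a \<le> a'" "w * (b + c) \<le> 1 * (b + c)" "w * (- b - c) \<le> w * d"
    for a a' b c d w :: real
  proof -
    have "- (w * d) \<le> w * (b + c)" using that(3) by (simp add: algebra_simps)
    also have "\<dots> \<le> b + c" using that(2) by simp
    finally show ?thesis using that(1) by simp
  qed
  from this[OF 1 2 3] show ?thesis unfolding xy_eq .
qed

end

section \<open>The limit of fine discretisation\<close>

text \<open>\<open>ln (1 - u)\<close> differs from \<open>- u\<close> by at most
  \<open>2 * u\<^sup>2\<close>, and \<open>K\<close> times this tends to 0 because
  \<open>K * u\<close> converges.\<close>

lemma tendsto_one_minus_power:
  fixes u :: "nat \<Rightarrow> real"
  assumes lim: "(\<lambda>K. real K * u K) \<longlonglongrightarrow> s"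
  shows "(\<lambda>K. (1 - u K) ^ K) \<longlonglongrightarrow> exp (- s)"
proof -
  have u0: "u \<longlonglongrightarrow> 0"
  proof -
    have "(\<lambda>K. real K * u K * (1 / real K)) \<longlonglongrightarrow> s * 0"
      by (intro tendsto_mult lim lim_1_over_n)
    moreover have "eventually (\<lambda>K. real K * u K * (1 / real K) = u K) sequentially"
      using eventually_gt_at_top[of 0] by eventually_elim simp
    ultimately show ?thesis using tendsto_cong by fastforce
  qed
  then have small: "eventually (\<lambda>K. \<bar>u K\<bar> < 1 / 2) sequentially"
    by (auto dest: tendstoD[where e="1 / 2"] simp: dist_real_def)
  have "(\<lambda>K. 2 * (real K * u K) * u K) \<longlonglongrightarrow> 2 * s * 0"
    by (intro tendsto_intros lim u0)
  then have err: "(\<lambda>K. 2 * (real K * u K) * u K) \<longlonglongrightarrow> 0" by simp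
  have "eventually (\<lambda>K. norm (real K * ln (1 - u K) + real K * u K) \<le> norm (2 * (real K * u K) * u K)) sequentially"
    using small
  proof eventually_elim
    case (elim K)
    have "\<bar>ln (1 + - u K) - - u K\<bar> \<le> 2 * (- u K)\<^sup>2"
      using elim by (intro abs_ln_one_plus_x_minus_x_bound) auto
    then have "real K * \<bar>ln (1 - u K) + u K\<bar> \<le> real K * (2 * (u K)\<^sup>2)"
      by (intro mult_left_mono) auto
    moreover have "real K * ln (1 - u K) + real K * u K = real K * (ln (1 - u K) + u K)"
      by (simp add: algebra_simps)
    ultimately show ?case by (simp add: abs_mult power2_eq_square mult_ac)
  qed
  then have "(\<lambda>K. real K * ln (1 - u K) + real K * u K) \<longlonglongrightarrow> 0"
    by (intro tendsto_0_le[OF err, where K=1]) simp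
  from tendsto_diff[OF this lim] have "(\<lambda>K. real K * ln (1 - u K)) \<longlonglongrightarrow> - s" by simp
  then have "(\<lambda>K. exp (real K * ln (1 - u K))) \<longlonglongrightarrow> exp (- s)" by (rule tendsto_exp)
  moreover have "eventually (\<lambda>K. exp (real K * ln (1 - u K)) = (1 - u K) ^ K) sequentially"
    using small by eventually_elim (simp add: exp_of_nat_mult)
  ultimately show ?thesis by (rule Lim_transform_eventually)
qed

text \<open>\<open>lam\<close> is the smaller root of the characteristic quadratic, \<open>s\<close>
  is the square root of its discriminant up to scaling, and \<open>v + \<kappa> = s / l\<close>. The
  coefficient of the slow mode for a unit of energy in the larger part then works out as
  \<open>1 + D\<close>.\<close>

lemma energy_constants_theta:
  fixes k l :: nat and n lam v \<kappa> :: real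
  assumes kl: "1 \<le> k" "k \<le> l"
  defines "n \<equiv> real (k + l)" and "lam \<equiv> theta k l * real k"
  defines "v \<equiv> 3 - 4 * lam / l" and "\<kappa> \<equiv> (3 * real k - 4 * lam) / l"
  shows "energy_constants k l n lam (3 / 4 * n - lam) v \<kappa>"
    and "theta k l \<in> {1 / 2..2 / 3}"
    and "(1 + \<kappa>) / (v + \<kappa>) * v = 1 + D_const (k / n)"
    and "0 \<le> (1 + \<kappa>) / (v + \<kappa>)" "(1 + \<kappa>) / (v + \<kappa>) \<le> 1"
proof -
  define s where "s = sqrt (9 * n\<^sup>2 - 32 * real k * real l)"
  have n: "n = real k + real l" "0 < n" and k: "1 \<le> real k" and l: "real k \<le> real l" "0 < real l"
    using kl by (auto simp: n_def)
  \<comment> \<open>In this form the discriminant is visibly nonnegative and \<open>s\<close> at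
    least \<open>n\<close>.\<close>
  have disc: "9 * n\<^sup>2 - 32 * real k * real l = n\<^sup>2 + 8 * (real l - real k)\<^sup>2"
    by (simp add: n power2_eq_square algebra_simps)
  have disc0: "0 \<le> 9 * n\<^sup>2 - 32 * real k * real l" unfolding disc by simp
  have s2: "s\<^sup>2 = 9 * n\<^sup>2 - 32 * real k * real l" and s0: "0 \<le> s" using disc0 by (auto simp: s_def)
  have kk: "real k * real k \<le> real k * real l" "real k * real l \<le> real l * real l"
    using kl by (auto intro: mult_mono)
  \<comment> \<open>As \<open>lam\<close> will be \<open>(3 * n - s) / 8\<close>, the four bounds on
    \<open>s\<close> are in this order \<open>lam \<le> n / 4\<close>,
    \<open>real k / 2 \<le> lam\<close>, \<open>lam \<le> 2 / 3 * real k\<close> and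
    \<open>lam \<le> l / 2\<close>.\<close>
  have "n \<le> s" unfolding s_def by (rule real_le_rsqrt) (simp add: disc)
  have s_upper: "s \<le> 3 * n - 4 * real k"
    unfolding s_def using kk l by (intro real_le_lsqrt) (auto simp: n power2_eq_square algebra_simps)
  have s_lower: "3 * n - 16 / 3 * real k \<le> s"
    unfolding s_def by (rule real_le_rsqrt) (use kk in \<open>simp add: n power2_eq_square algebra_simps\<close>)
  have s_lower': "3 * n - 4 * real l \<le> s"
    unfolding s_def by (rule real_le_rsqrt) (use kk in \<open>simp add: n power2_eq_square algebra_simps\<close>)
  have nk: "n - real k = real l" using n by simp
  have "1 - 32 / 9 * (real k / n) * ((n - real k) / n) = (9 * n\<^sup>2 - 32 * real k * real l) / (3 * n)\<^sup>2"
    unfolding nk using n(2) by (simp add: field_simps power2_eq_square)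
  then have "sqrt (1 - 32 / 9 * (real k / n) * ((n - real k) / n)) = s / (3 * n)"
    using n by (simp add: real_sqrt_divide s_def)
  then have theta: "theta k l = (3 * n - s) / (8 * real k)"
    unfolding theta_def Let_def n_def[symmetric] using n by (simp add: field_simps)
  then have lam: "lam = (3 * n - s) / 8" using k by (simp add: lam_def)
  have lam_bounds: "real k / 2 \<le> lam" "lam \<le> 2 / 3 * real k" "lam \<le> l / 2" "lam \<le> n / 4"
    unfolding lam using s_upper s_lower s_lower' \<open>n \<le> s\<close> by simp_all
  show "theta k l \<in> {1 / 2..2 / 3}"
    using lam_bounds(1,2) k by (simp add: lam_def)
  show const: "energy_constants k l n lam (3 / 4 * n - lam) v \<kappa>"
  proof
    show "4 * lam\<^sup>2 - 3 * n * lam + 2 * real k * real l = 0"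
    proof -
      have "4 * lam\<^sup>2 - 3 * n * lam + 2 * real k * real l = (s\<^sup>2 - 9 * n\<^sup>2 + 32 * real k * real l) / 16"
        by (simp add: lam power2_eq_square field_simps)
      then show ?thesis by (simp add: s2)
    qed
    show "v * real l = 3 * real l - 4 * lam" "\<kappa> * real l = 3 * real k - 4 * lam"
      using l by (simp_all add: v_def \<kappa>_def field_simps)
    show "lam \<le> 3 / 4 * real k" using lam_bounds(2) k by simp
  qed (use k l n lam_bounds in auto)
  interpret c: energy_constants k l n lam "3 / 4 * n - lam" v \<kappa> by (rule const)
  show "0 \<le> (1 + \<kappa>) / (v + \<kappa>)" "(1 + \<kappa>) / (v + \<kappa>) \<le> 1"
    using c.bounds by (auto simp: field_simps)
  have v': "v = (3 * real l - 3 * real k + s) / (2 * real l)" and \<kappa>': "1 + \<kappa> = (3 * real k - real l + s) / (2 * real l)"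
    and sum: "v + \<kappa> = s / l"
    unfolding v_def \<kappa>_def lam n(1) using l by (simp_all add: field_simps)
  have "sqrt (9 - 32 * (k / n) + 32 * (k / n)\<^sup>2) = s / n"
  proof -
    have "9 - 32 * (k / n) + 32 * (k / n)\<^sup>2 = (9 * n\<^sup>2 - 32 * real k * real l) / n\<^sup>2"
      unfolding nk[symmetric] using n(2) by (simp add: field_simps power2_eq_square)
    then show ?thesis using n by (simp add: real_sqrt_divide s_def)
  qed
  then have D: "1 + D_const (k / n) = (3 * real l - real k + s) / (2 * s)"
    using n \<open>n \<le> s\<close> unfolding D_const_def by (simp add: field_simps)
  \<comment> \<open>Replacing \<open>s\<^sup>2\<close> by the discriminant produces the factor
    \<open>2 * real l\<close>, which cancels against the denominator.\<close>
  have "(3 * real k - real l + s) * (3 * real l - 3 * real k + s) = (3 * real k - real l) * (3 * real l - 3 * real k) + 2 * real l * s + s\<^sup>2"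
    by (simp add: power2_eq_square algebra_simps)
  also have "\<dots> = 2 * real l * (3 * real l - real k + s)"
    unfolding s2 by (simp add: n power2_eq_square algebra_simps)
  finally have num: "(3 * real k - real l + s) * (3 * real l - 3 * real k + s) = 2 * real l * (3 * real l - real k + s)" .
  have s: "0 < s" using n \<open>n \<le> s\<close> by linarith
  have "(1 + \<kappa>) / (v + \<kappa>) * v = ((3 * real k - real l + s) * (3 * real l - 3 * real k + s)) / (4 * real l * s)"
    unfolding \<kappa>' sum unfolding v' using l s by (simp add: divide_simps)
  also have "\<dots> = 1 + D_const (k / n)"
    unfolding num D using l s by (simp add: field_simps)
  finally show "(1 + \<kappa>) / (v + \<kappa>) * v = 1 + D_const (k / n)" .
qed

lemma grid_ring_rate_limit:
  fixes t :: real
  shows "(\<lambda>K. real K * ((1 - exp (- t / real K)) * exp (- t / real K) ^ j)) \<longlonglongrightarrow> t"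
proof -
  have "(\<lambda>K. real K * (1 - exp (- t / real K))) \<longlonglongrightarrow> t"
    by real_asymp
  moreover have "(\<lambda>K. exp (- t / real K) ^ j) \<longlonglongrightarrow> exp 0 ^ j"
    by (intro tendsto_power tendsto_exp lim_const_over_n)
  ultimately have "(\<lambda>K. real K * (1 - exp (- t / real K)) * exp (- t / real K) ^ j) \<longlonglongrightarrow> t * exp 0 ^ j"
    by (rule tendsto_mult)
  then show ?thesis by (simp add: mult.assoc)
qed

text \<open>The recursion bounds in the limit of large \<open>K\<close>, with graph and time fixed:
  since \<open>K * \<rho> K\<close> tends to \<open>t\<close>, the powers become exponentials, and
  the comparison error \<open>e / K\<close> vanishes.\<close>

lemma bipartite_energy_bounds:
  fixes k l :: nat and t lam lam2 v \<kappa> n W :: real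
  assumes proc: "averaging_process M (bipartite_vertices k l) (bipartite_edges k l) \<xi> \<eta>"
    and kl: "1 \<le> k" "k \<le> l" and t: "0 < t"
    and const: "energy_constants k l n lam lam2 v \<kappa>"
  defines "W \<equiv> (1 + \<kappa>) / (v + \<kappa>)"
    and "En \<equiv> prob_space.expectation M (\<lambda>\<omega>. left_energy k l (\<eta> t \<omega>) + right_energy k l (\<eta> t \<omega>))"
  shows "En \<le> W * v * exp (- (lam * t)) + exp (- (lam2 * t))"
    and "W * (exp (- (lam * t)) * (v * right_energy k l \<xi> - 6 / n - 18 * lam * t / n))
      - exp (- (lam2 * t)) - 6 / n * exp (- (lam * t)) \<le> En"
proof -
  let ?V = "bipartite_vertices k l" and ?E = "bipartite_edges k l"
  let ?S = "prob_mass_functions ?V" and ?L = "left_energy k l" and ?R = "right_energy k l" and ?I = "imbalance k l"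
  interpret prob_space M using proc by (simp add: averaging_process_def)
  interpret c: energy_constants k l n lam lam2 v \<kappa> by (rule const)
  have \<xi>: "\<xi> \<in> ?S" using proc by (simp add: averaging_process_def)
  have n: "n = real k + real l" "0 < n" using c.n c.bounds by auto
  have l1: "1 \<le> l" using kl by simp
  note bounds = energies_bounds[OF kl(1) l1]
  define j where "j = card ?E - 1"
  define \<rho> where "\<rho> K = (1 - exp (- t / real K)) * exp (- t / real K) ^ j" for K :: nat
  define e where "e = 2 * (real ((card ?E)\<^sup>2) * t\<^sup>2)"
  have K\<rho>: "(\<lambda>K. real K * \<rho> K) \<longlonglongrightarrow> t"
    unfolding \<rho>_def by (rule grid_ring_rate_limit)
  have "(\<lambda>K. real K * \<rho> K * (n / real K)) \<longlonglongrightarrow> t * 0"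
    by (intro tendsto_mult K\<rho> lim_const_over_n)
  then have "eventually (\<lambda>K. real K * \<rho> K * (n / real K) < 1 / 2) sequentially"
    by (rule order_tendstoD) simp
  then have large: "eventually (\<lambda>K. 0 < K \<and> \<rho> K * n \<le> 1 / 2) sequentially"
    using eventually_gt_at_top[of 0] by eventually_elim simp
  have meas: "(\<lambda>\<omega>. ?L (\<eta> t \<omega>) + ?R (\<eta> t \<omega>)) \<in> borel_measurable M"
  proof -
    have "(\<lambda>\<omega>. \<eta> t \<omega> x) \<in> borel_measurable M" if "x \<in> ?V" for x
      using proc t that by (simp add: averaging_process_def)
    then show ?thesis
      unfolding left_energy_def right_energy_def
      by (intro borel_measurable_add borel_measurable_sum borel_measurable_power borel_measurable_diff)
        (auto simp: bipartite_vertices_def)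
  qed
  have main: "En \<le> W * v * (1 - \<rho> K * lam) ^ K + (1 - \<rho> K * lam2) ^ K + e / K \<and>
      W * ((1 - \<rho> K * lam) ^ K * (v * ?R \<xi> - 6 / n - K * (18 * \<rho> K * lam / n)))
      - (1 - \<rho> K * lam2) ^ K - 6 / n * (1 - \<rho> K * lam) ^ K - e / K \<le> En"
    if K: "0 < K" "\<rho> K * n \<le> 1 / 2" for K
  proof -
    obtain \<zeta> where \<zeta>: "\<And>\<omega>. \<zeta> 0 \<omega> = \<xi>" "\<And>i \<omega>. \<zeta> i \<omega> \<in> ?S"
      "\<And>i q. i \<le> K \<Longrightarrow> (\<lambda>\<omega>. q (\<zeta> i \<omega>) :: real) \<in> borel_measurable M"
      and step: "\<And>i q C. i < K \<Longrightarrow> (\<And>s. s \<in> ?S \<Longrightarrow> \<bar>q s\<bar> \<le> C) \<Longrightarrow>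
        expectation (\<lambda>\<omega>. q (\<zeta> (Suc i) \<omega>)) = expectation (\<lambda>\<omega>. q (\<zeta> i \<omega>)) +
          (1 - exp (- t / K)) * exp (- t / K) ^ (card ?E - 1) *
          expectation (\<lambda>\<omega>. \<Sum>e\<in>?E. q (edge_op e (\<zeta> i \<omega>)) - q (\<zeta> i \<omega>))"
      and approx: "\<And>q C. (\<lambda>\<omega>. q (\<eta> t \<omega>)) \<in> borel_measurable M \<Longrightarrow>
        (\<And>s. s \<in> ?S \<Longrightarrow> \<bar>q s\<bar> \<le> C) \<Longrightarrow>
        \<bar>expectation (\<lambda>\<omega>. q (\<eta> t \<omega>)) - expectation (\<lambda>\<omega>. q (\<zeta> K \<omega>))\<bar>
          \<le> 2 * C * ((card ?E)\<^sup>2 * t\<^sup>2 / K)"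
      using averaging_process_grid_approximation[OF proc _ bipartite_edges_pairs t K(1)]
      by (auto simp: bipartite_vertices_def)
    have b1: "\<bar>?L s\<bar> \<le> 1" "\<bar>?R s\<bar> \<le> 1" "\<bar>?I s\<bar> \<le> 1" "\<bar>?L s + ?R s\<bar> \<le> 1" if "s \<in> ?S" for s
      using bounds[OF that] by auto
    have int: "integrable M (\<lambda>\<omega>. ?L (\<zeta> i \<omega>))" "integrable M (\<lambda>\<omega>. ?R (\<zeta> i \<omega>))"
        "integrable M (\<lambda>\<omega>. ?I (\<zeta> i \<omega>))" if "i \<le> K" for i
      using b1 \<zeta>(2,3) that by (auto intro!: integrable_const_bound[where B=1])
    define x where "x i = expectation (\<lambda>\<omega>. ?L (\<zeta> i \<omega>))" for i
    define y where "y i = expectation (\<lambda>\<omega>. ?R (\<zeta> i \<omega>))" for i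
    define z where "z i = expectation (\<lambda>\<omega>. ?I (\<zeta> i \<omega>))" for i
    interpret r: energy_recursion k l n lam lam2 v \<kappa> "\<rho> K" x y z K
    proof
      show "0 \<le> \<rho> K" using t by (simp add: \<rho>_def)
      show "\<rho> K * n \<le> 1 / 2" by (rule K)
      show "0 \<le> x i" "0 \<le> y i" "0 \<le> z i" for i
        unfolding x_def y_def z_def using bounds \<zeta>(2) by (auto intro!: Bochner_Integration.integral_nonneg)
      show "x 0 + y 0 \<le> 1" "z 0 \<le> 1"
        using bounds[OF \<xi>] by (simp_all add: x_def y_def z_def \<zeta>(1) prob_space)
      fix i assume i: "i < K"
      note I = int[OF less_imp_le[OF i]]
      have "x (Suc i) = x i + \<rho> K * expectation (\<lambda>\<omega>. - (3 / 4) * l * ?L (\<zeta> i \<omega>) + k / 4 * ?R (\<zeta> i \<omega>) - ?I (\<zeta> i \<omega>) / 2)"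
        using step[of i "?L" 1] i b1(1)
        by (simp only: x_def generator_left_energy[OF kl(1) l1 \<zeta>(2)] \<rho>_def j_def)
      then show "x (Suc i) = x i + \<rho> K * (- (3 / 4) * l * x i + k / 4 * y i - z i / 2)"
        using I by (simp add: x_def y_def z_def)
      have "y (Suc i) = y i + \<rho> K * expectation (\<lambda>\<omega>. l / 4 * ?L (\<zeta> i \<omega>) - 3 / 4 * k * ?R (\<zeta> i \<omega>) - ?I (\<zeta> i \<omega>) / 2)"
        using step[of i "?R" 1] i b1(2)
        by (simp only: y_def generator_right_energy[OF kl(1) l1 \<zeta>(2)] \<rho>_def j_def)
      then show "y (Suc i) = y i + \<rho> K * (l / 4 * x i - 3 / 4 * k * y i - z i / 2)"
        using I by (simp add: x_def y_def z_def)
      have "z (Suc i) = z i + \<rho> K * expectation (\<lambda>\<omega>. l / 4 * ?L (\<zeta> i \<omega>) + k / 4 * ?R (\<zeta> i \<omega>) - (k + l - 1 / 2) * ?I (\<zeta> i \<omega>))"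
        using step[of i "?I" 1] i b1(3)
        by (simp only: z_def generator_imbalance[OF kl(1) l1 \<zeta>(2)] \<rho>_def j_def)
      then show "z (Suc i) = z i + \<rho> K * (l / 4 * x i + k / 4 * y i - (n - 1 / 2) * z i)"
        using I by (simp add: x_def y_def z_def n)
    qed
    have "\<bar>En - expectation (\<lambda>\<omega>. ?L (\<zeta> K \<omega>) + ?R (\<zeta> K \<omega>))\<bar> \<le> 2 * 1 * ((card ?E)\<^sup>2 * t\<^sup>2 / K)"
      unfolding En_def by (rule approx[OF meas b1(4)])
    moreover have "expectation (\<lambda>\<omega>. ?L (\<zeta> K \<omega>) + ?R (\<zeta> K \<omega>)) = x K + y K"
      using int[of K] by (simp add: x_def y_def)
    ultimately have close: "\<bar>En - (x K + y K)\<bar> \<le> e / K" by (simp add: e_def)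
    have y0: "y 0 = ?R \<xi>" by (simp add: y_def \<zeta>(1) prob_space)
    have "En \<le> a + d \<and> a' - d \<le> En" if "\<bar>En - c\<bar> \<le> d" "c \<le> a" "a' \<le> c" for a a' c d :: real
      using that by linarith
    from this[OF close r.energy_upper r.energy_lower] show ?thesis
      unfolding r.r_def r.q_def W_def[symmetric] y0 .
  qed
  have pow: "(\<lambda>K. (1 - \<rho> K * a) ^ K) \<longlonglongrightarrow> exp (- (a * t))" for a
  proof -
    have "(\<lambda>K. real K * \<rho> K * a) \<longlonglongrightarrow> t * a" by (intro tendsto_mult K\<rho> tendsto_const)
    then show ?thesis
      using tendsto_one_minus_power[of "\<lambda>K. \<rho> K * a" "t * a"] by (simp add: mult_ac)
  qed
  have "(\<lambda>K. W * v * (1 - \<rho> K * lam) ^ K + (1 - \<rho> K * lam2) ^ K + e / real K)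
      \<longlonglongrightarrow> W * v * exp (- (lam * t)) + exp (- (lam2 * t)) + 0"
    by (intro tendsto_intros pow lim_const_over_n)
  moreover have "eventually (\<lambda>K. En \<le> W * v * (1 - \<rho> K * lam) ^ K + (1 - \<rho> K * lam2) ^ K + e / real K) sequentially"
    using large by eventually_elim (use main in blast)
  ultimately show "En \<le> W * v * exp (- (lam * t)) + exp (- (lam2 * t))"
    using tendsto_lowerbound[of _ _ sequentially En] by fastforce
  have "(\<lambda>K. W * ((1 - \<rho> K * lam) ^ K * (v * ?R \<xi> - 6 / n - real K * \<rho> K * (18 * lam / n)))
      - (1 - \<rho> K * lam2) ^ K - 6 / n * (1 - \<rho> K * lam) ^ K - e / real K)
      \<longlonglongrightarrow> W * (exp (- (lam * t)) * (v * ?R \<xi> - 6 / n - t * (18 * lam / n)))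
      - exp (- (lam2 * t)) - 6 / n * exp (- (lam * t)) - 0"
    by (intro tendsto_intros pow K\<rho> lim_const_over_n)
  moreover have "eventually (\<lambda>K. W * ((1 - \<rho> K * lam) ^ K * (v * ?R \<xi> - 6 / n - real K * \<rho> K * (18 * lam / n)))
      - (1 - \<rho> K * lam2) ^ K - 6 / n * (1 - \<rho> K * lam) ^ K - e / real K \<le> En) sequentially"
    using large by eventually_elim (use main in \<open>simp add: mult_ac\<close>)
  ultimately have "W * (exp (- (lam * t)) * (v * ?R \<xi> - 6 / n - t * (18 * lam / n)))
      - exp (- (lam2 * t)) - 6 / n * exp (- (lam * t)) - 0 \<le> En"
    by (rule tendsto_upperbound) simp
  then show "W * (exp (- (lam * t)) * (v * ?R \<xi> - 6 / n - 18 * lam * t / n))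
      - exp (- (lam2 * t)) - 6 / n * exp (- (lam * t)) \<le> En"
    by (simp add: mult_ac)
qed

section \<open>The distance at the mixing time\<close>

text \<open>The upper bound is the maximum, attained at \<open>b = 3 / 8\<close>, where the square
  in the proof vanishes. The lower bound is attained at both ends of the interval.\<close>

lemma D_const_bounds:
  assumes b: "0 \<le> b" "b \<le> 1 / 2"
  shows "D_const b \<in> {0..(sqrt 6 - 2) / 4}" "0 < 9 - 32 * b + 32 * b\<^sup>2"
proof -
  define S where "S = sqrt (9 - 32 * b + 32 * b\<^sup>2)"
  have disc: "9 - 32 * b + 32 * b\<^sup>2 = 1 + 8 * (1 - 2 * b)\<^sup>2"
    by (simp add: power2_eq_square algebra_simps)
  show pos: "0 < 9 - 32 * b + 32 * b\<^sup>2"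
    unfolding disc by (simp add: add_pos_nonneg)
  then have S: "0 < S" by (simp add: S_def)
  have D: "D_const b = (3 - 4 * b - S) / (2 * S)" by (simp add: D_const_def S_def)
  have "b * b \<le> b * (1 / 2)" using b by (intro mult_left_mono) auto
  then have "S \<le> 3 - 4 * b"
    unfolding S_def using b by (intro real_le_lsqrt) (auto simp: power2_eq_square algebra_simps)
  then have "0 \<le> D_const b" using S by (simp add: D)
  moreover have "3 - 4 * b \<le> sqrt 6 / 2 * S"
  proof -
    have "3 - 4 * b \<le> sqrt (6 / 4 * (9 - 32 * b + 32 * b\<^sup>2))"
    proof (rule real_le_rsqrt)
      have "6 / 4 * (9 - 32 * b + 32 * b\<^sup>2) - (3 - 4 * b)\<^sup>2 = 32 * (b - 3 / 8)\<^sup>2"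
        by (simp add: power2_eq_square field_simps)
      then show "(3 - 4 * b)\<^sup>2 \<le> 6 / 4 * (9 - 32 * b + 32 * b\<^sup>2)"
        using zero_le_power2[of "b - 3 / 8"] by linarith
    qed
    also have "\<dots> = sqrt 6 / sqrt 4 * S"
      unfolding S_def real_sqrt_mult real_sqrt_divide ..
    finally show ?thesis by simp
  qed
  then have "D_const b \<le> (sqrt 6 - 2) / 4"
    using S by (simp add: D field_simps)
  ultimately show "D_const b \<in> {0..(sqrt 6 - 2) / 4}" by simp
qed

lemma tendsto_D_const:
  assumes "(\<beta> \<longlongrightarrow> b) F" "0 \<le> b" "b \<le> 1 / 2"
  shows "((\<lambda>x. D_const (\<beta> x)) \<longlongrightarrow> D_const b) F"
proof -
  have "0 < 9 - 32 * b + 32 * b\<^sup>2" by (rule D_const_bounds(2)[OF assms(2,3)])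
  then have "2 * sqrt (9 - 32 * b + 32 * b\<^sup>2) \<noteq> 0" by simp
  then show ?thesis unfolding D_const_def by (intro tendsto_intros assms(1))
qed

lemma L2_norm_density_bipartite:
  assumes "1 \<le> k + l"
  shows "(L2_norm (bipartite_vertices k l) (uniform_mass (bipartite_vertices k l))
      (\<lambda>x. \<eta> x / uniform_mass (bipartite_vertices k l) x - 1))\<^sup>2
    = real (k + l) * (left_energy k l \<eta> + right_energy k l \<eta>)"
proof -
  let ?V = "bipartite_vertices k l"
  define n where "n = real (k + l)"
  have n: "0 < n" using assms by (simp add: n_def)
  have u: "uniform_mass ?V x = 1 / n" for x
    by (simp add: uniform_mass_def bipartite_vertices_def n_def)
  have "(L2_norm ?V (uniform_mass ?V) (\<lambda>x. \<eta> x / uniform_mass ?V x - 1))\<^sup>2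
      = (\<Sum>x\<in>?V. 1 / n * (\<eta> x * n - 1)\<^sup>2)"
    unfolding L2_norm_def using n by (simp add: u sum_nonneg)
  also have "\<dots> = (\<Sum>x\<in>?V. n * (\<eta> x - 1 / n)\<^sup>2)"
    using n by (intro sum.cong) (auto simp: power2_eq_square field_simps)
  also have "\<dots> = n * (\<Sum>x\<in>?V. (\<eta> x - 1 / n)\<^sup>2)"
    by (simp add: sum_distrib_left)
  also have "(\<Sum>x\<in>?V. (\<eta> x - 1 / n)\<^sup>2) = left_energy k l \<eta> + right_energy k l \<eta>"
    by (simp add: sum_bipartite_vertices left_energy_def right_energy_def n_def)
  finally show ?thesis by (simp add: n_def)
qed

definition point_mass :: "'a \<Rightarrow> 'a \<Rightarrow> real" where
  "point_mass x = (\<lambda>y. if y = x then 1 else 0)"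

text \<open>Vertex \<open>k\<close> is the first of the second part. The energy bound keeps only the
  contribution of \<open>k\<close> itself.\<close>

lemma point_mass_right:
  assumes "1 \<le> l"
  shows "point_mass k \<in> prob_mass_functions (bipartite_vertices k l)"
    and "1 - 2 / real (k + l) \<le> right_energy k l (point_mass k)"
proof -
  show "point_mass k \<in> prob_mass_functions (bipartite_vertices k l)"
    using assms by (auto simp: point_mass_def prob_mass_functions_def bipartite_vertices_def)
  have "1 - 2 / real (k + l) \<le> (1 - 1 / real (k + l))\<^sup>2"
    by (simp add: power2_diff)
  also have "\<dots> = (\<Sum>y\<in>{k}. (point_mass k y - 1 / real (k + l))\<^sup>2)"
    by (simp add: point_mass_def)
  also have "\<dots> \<le> right_energy k l (point_mass k)"
    unfolding right_energy_def using assms by (intro sum_mono2) auto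
  finally show "1 - 2 / real (k + l) \<le> right_energy k l (point_mass k)" .
qed

text \<open>The time is chosen so that \<open>lam * t = ln n + a\<close>: then
  \<open>n * exp (- (lam * t))\<close> is \<open>exp (- a)\<close>, and as
  \<open>2 * lam \<le> lam2\<close>, the fast mode contributes at most
  \<open>exp (- (2 * a)) / n\<close>. Of \<open>18 / n\<close>, a third each is due to the energy
  missing in the larger part, to the initial correction in \<omega> and to
  \<open>\<psi>_lower\<close>.\<close>

lemma bipartite_distance_at_mixing_time:
  fixes k l :: nat and a n D :: real
  assumes kl: "1 \<le> k" "k \<le> l"
  defines "n \<equiv> real (k + l)" and "D \<equiv> D_const (k / n)"
  assumes a: "0 < ln n + a"
    and proc: "averaging_process M (bipartite_vertices k l) (bipartite_edges k l) \<xi> \<eta>"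
  defines "d \<equiv> prob_space.expectation M (\<lambda>\<omega>. (L2_norm (bipartite_vertices k l)
      (uniform_mass (bipartite_vertices k l))
      (\<lambda>x. \<eta> (mixing_time k l a) \<omega> x / uniform_mass (bipartite_vertices k l) x - 1))\<^sup>2)"
  shows "d \<le> (1 + D) * exp (- a) + exp (- (2 * a)) / n"
    and "1 - 2 / n \<le> right_energy k l \<xi> \<Longrightarrow>
      exp (- a) * ((1 + D) - 18 / n - 18 * (ln n + a) / n) - exp (- (2 * a)) / n \<le> d"
proof -
  define lam where "lam = theta k l * real k"
  define lam2 where "lam2 = 3 / 4 * n - lam"
  define v where "v = 3 - 4 * lam / real l"
  define \<kappa> where "\<kappa> = (3 * real k - 4 * lam) / real l"
  define W where "W = (1 + \<kappa>) / (v + \<kappa>)"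
  define t where "t = mixing_time k l a"
  define En where "En = prob_space.expectation M (\<lambda>\<omega>. left_energy k l (\<eta> t \<omega>) + right_energy k l (\<eta> t \<omega>))"
  note defs = n_def lam_def lam2_def v_def \<kappa>_def
  have const: "energy_constants k l n lam lam2 v \<kappa>"
    unfolding defs by (rule energy_constants_theta[OF kl])
  have W: "W * v = 1 + D" "0 \<le> W" "W \<le> 1"
    unfolding W_def D_def defs by (rule energy_constants_theta[OF kl])+
  interpret c: energy_constants k l n lam lam2 v \<kappa> by (rule const)
  have n: "0 < n" using c.bounds by simp
  have lam_t: "lam * t = ln n + a"
  proof -
    have "t = ln n / lam + a / lam" by (simp add: t_def mixing_time_def lam_def n_def)
    then show ?thesis using c.bounds(7) by (simp add: field_simps)
  qed
  have t: "0 < t" using a c.bounds(7) lam_t by (metis zero_less_mult_pos)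
  have e1: "exp (- (lam * t)) = exp (- a) / n"
  proof -
    have "exp (- (lam * t)) = exp (- a) * exp (- ln n)" by (simp add: lam_t flip: exp_add)
    then show ?thesis using n by (simp add: exp_minus field_simps)
  qed
  have e2: "exp (- (lam2 * t)) \<le> exp (- (2 * a)) / n\<^sup>2"
  proof -
    have "2 * lam * t \<le> lam2 * t" using c.bounds c.lam t by (intro mult_right_mono) auto
    then have "exp (- (lam2 * t)) \<le> exp (- (lam * t) + - (lam * t))" by simp
    also have "\<dots> = exp (- a) / n * (exp (- a) / n)" by (simp only: exp_add e1)
    also have "\<dots> = exp (- (2 * a)) / n\<^sup>2" by (simp add: power2_eq_square flip: exp_add)
    finally show ?thesis .
  qed
  then have e2': "n * exp (- (lam2 * t)) \<le> exp (- (2 * a)) / n"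
    using mult_left_mono[OF e2, of n] n by (simp add: power2_eq_square)
  have d: "d = n * En"
  proof -
    have "d = prob_space.expectation M (\<lambda>\<omega>. n * (left_energy k l (\<eta> t \<omega>) + right_energy k l (\<eta> t \<omega>)))"
      unfolding d_def t_def n_def using kl by (subst L2_norm_density_bipartite) auto
    then show ?thesis by (simp add: En_def)
  qed
  have "En \<le> W * v * exp (- (lam * t)) + exp (- (lam2 * t))"
    unfolding W_def En_def by (rule bipartite_energy_bounds(1)[OF proc kl t const])
  then have "d \<le> n * (W * v * exp (- (lam * t)) + exp (- (lam2 * t)))"
    unfolding d using n by (intro mult_left_mono) auto
  also have "\<dots> = (1 + D) * exp (- a) + n * exp (- (lam2 * t))"
    unfolding W(1) e1 using n by (simp add: field_simps)
  also have "\<dots> \<le> (1 + D) * exp (- a) + exp (- (2 * a)) / n" using e2' by simp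
  finally show "d \<le> (1 + D) * exp (- a) + exp (- (2 * a)) / n" .
  assume R: "1 - 2 / n \<le> right_energy k l \<xi>"
  have "v * (2 / n) \<le> 3 * (2 / n)" using c.bounds by (intro mult_right_mono) auto
  then have "v - 6 / n \<le> v - v * (2 / n)" by simp
  also have "\<dots> = v * (1 - 2 / n)" by (simp add: algebra_simps)
  also have "\<dots> \<le> v * right_energy k l \<xi>"
    using R c.bounds by (intro mult_left_mono) auto
  finally have vR: "v - 6 / n - 6 / n - 18 * (ln n + a) / n \<le> v * right_energy k l \<xi> - 6 / n - 18 * (ln n + a) / n"
    by simp
  define err where "err = 6 / n + 6 / n + 18 * (ln n + a) / n"
  have err: "0 \<le> err" using n a by (simp add: err_def)
  \<comment> \<open>\<open>W * v\<close> is exactly \<open>1 + D\<close>, and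
    \<open>W \<le> 1\<close> keeps the error from growing.\<close>
  have "(1 + D) - err \<le> W * (v - err)"
    using mult_right_mono[OF W(3) err] W(1) by (simp add: algebra_simps)
  also have "\<dots> \<le> W * (v * right_energy k l \<xi> - 6 / n - 18 * (ln n + a) / n)"
    using vR W(2) by (intro mult_left_mono) (auto simp: err_def)
  finally have main: "exp (- a) * ((1 + D) - err) \<le> exp (- a) * (W * (v * right_energy k l \<xi> - 6 / n - 18 * (ln n + a) / n))"
    by (intro mult_left_mono) auto
  have "W * (exp (- (lam * t)) * (v * right_energy k l \<xi> - 6 / n - 18 * lam * t / n))
      - exp (- (lam2 * t)) - 6 / n * exp (- (lam * t)) \<le> En"
    unfolding W_def En_def by (rule bipartite_energy_bounds(2)[OF proc kl t const])
  then have "n * (W * (exp (- (lam * t)) * (v * right_energy k l \<xi> - 6 / n - 18 * (lam * t) / n))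
      - exp (- (lam2 * t)) - 6 / n * exp (- (lam * t))) \<le> d"
    unfolding d using n by (intro mult_left_mono) (auto simp: mult_ac)
  also have "n * (W * (exp (- (lam * t)) * (v * right_energy k l \<xi> - 6 / n - 18 * (lam * t) / n))
      - exp (- (lam2 * t)) - 6 / n * exp (- (lam * t)))
    = exp (- a) * (W * (v * right_energy k l \<xi> - 6 / n - 18 * (ln n + a) / n))
      - n * exp (- (lam2 * t)) - 6 / n * exp (- a)"
    unfolding e1 unfolding lam_t right_diff_distrib[of n] using n by simp
  finally have "exp (- a) * ((1 + D) - err) - exp (- (2 * a)) / n - 6 / n * exp (- a) \<le> d"
    using main e2' by linarith
  then show "exp (- a) * ((1 + D) - 18 / n - 18 * (ln n + a) / n) - exp (- (2 * a)) / n \<le> d"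
    by (simp add: err_def algebra_simps)
qed

theorem theorem1p3:
  fixes m :: "nat \<Rightarrow> nat" and b :: real
    and M :: "nat \<Rightarrow> (nat \<Rightarrow> real) \<Rightarrow> 'w measure"
    and \<eta> :: "nat \<Rightarrow> (nat \<Rightarrow> real) \<Rightarrow> real \<Rightarrow> 'w \<Rightarrow> nat \<Rightarrow> real"
    and V :: "nat \<Rightarrow> nat set" and E :: "nat \<Rightarrow> nat set set" and \<pi> :: "nat \<Rightarrow> nat \<Rightarrow> real"
  defines "V \<equiv> \<lambda>n. bipartite_vertices (m n) (n - m n)"
    and "E \<equiv> \<lambda>n. bipartite_edges (m n) (n - m n)"
    and "\<pi> \<equiv> \<lambda>n. uniform_mass (V n)"
  assumes m: "\<And>n. 2 \<le> n \<Longrightarrow> 1 \<le> m n \<and> real (m n) \<le> real n / 2"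
    and b: "b \<in> {0..1/2}" "(\<lambda>n. real (m n) / real n) \<longlonglongrightarrow> b"
    and process: "\<And>n \<xi>. 2 \<le> n \<Longrightarrow> \<xi> \<in> prob_mass_functions (V n) \<Longrightarrow>
      averaging_process (M n \<xi>) (V n) (E n) \<xi> (\<eta> n \<xi>)"
  shows "(\<forall>n\<ge>2. theta (m n) (n - m n) \<in> {1/2..2/3}) \<and>
    D_const b \<in> {0..(sqrt 6 - 2) / 4} \<and>
    (\<forall>a. (\<lambda>n. SUP \<xi>\<in>prob_mass_functions (V n).
        prob_space.expectation (M n \<xi>) (\<lambda>\<omega>.
          (L2_norm (V n) (\<pi> n)
            (\<lambda>x. \<eta> n \<xi> (mixing_time (m n) (n - m n) a) \<omega> x / \<pi> n x - 1))\<^sup>2))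
      \<longlonglongrightarrow> (1 + D_const b) * exp (- a))"
proof (intro conjI allI impI)
  have parts: "1 \<le> m n" "m n \<le> n - m n" "m n + (n - m n) = n" if "2 \<le> n" for n
    using m[OF that] by linarith+
  show "theta (m n) (n - m n) \<in> {1/2..2/3}" if "2 \<le> n" for n
    using energy_constants_theta(2)[OF parts(1,2)[OF that]] .
  show "D_const b \<in> {0..(sqrt 6 - 2) / 4}" using b(1) by (intro D_const_bounds) auto
  fix a :: real
  define d where "d n \<xi> = prob_space.expectation (M n \<xi>) (\<lambda>\<omega>. (L2_norm (V n) (\<pi> n)
    (\<lambda>x. \<eta> n \<xi> (mixing_time (m n) (n - m n) a) \<omega> x / \<pi> n x - 1))\<^sup>2)" for n \<xi>
  define D where "D n = D_const (real (m n) / real n)" for n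
  define upper where "upper n = (1 + D n) * exp (- a) + exp (- (2 * a)) / real n" for n
  define lower where "lower n = exp (- a) * ((1 + D n) - 18 / real n - 18 * (ln (real n) + a) / real n)
    - exp (- (2 * a)) / real n" for n
  have D: "D \<longlonglongrightarrow> D_const b"
    unfolding D_def using b by (intro tendsto_D_const) auto
  have "filterlim (\<lambda>n. ln (real n) + a) at_top sequentially" by real_asymp
  then have "eventually (\<lambda>n. 0 < ln (real n) + a) sequentially"
    by (simp add: filterlim_at_top_dense)
  \<comment> \<open>The upper bound is uniform over the starting points, and for the lower one a
    single starting point suffices. Both hold once \<open>n\<close> is large enough for the mixing
    time to be positive.\<close>
  then have sandwich: "eventually (\<lambda>n. lower n \<le> (SUP \<xi>\<in>prob_mass_functions (V n). d n \<xi>) \<and>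
      (SUP \<xi>\<in>prob_mass_functions (V n). d n \<xi>) \<le> upper n) sequentially"
    using eventually_ge_at_top[of 2]
  proof eventually_elim
    case (elim n)
    note kl = parts[OF elim(2)]
    have a: "0 < ln (real (m n + (n - m n))) + a" using elim(1) kl(3) by simp
    have up: "d n \<xi> \<le> upper n" if "\<xi> \<in> prob_mass_functions (V n)" for \<xi>
      using bipartite_distance_at_mixing_time(1)[OF kl(1,2) a
          process[OF elim(2) that, unfolded V_def E_def]]
      unfolding d_def upper_def D_def \<pi>_def V_def kl(3) .
    let ?\<delta> = "point_mass (m n) :: nat \<Rightarrow> real"
    have \<delta>: "?\<delta> \<in> prob_mass_functions (V n)" "1 - 2 / real n \<le> right_energy (m n) (n - m n) ?\<delta>"
      using point_mass_right[of "n - m n" "m n"] kl by (auto simp: V_def)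
    have low: "lower n \<le> d n ?\<delta>"
      using bipartite_distance_at_mixing_time(2)[OF kl(1,2) a
          process[OF elim(2) \<delta>(1), unfolded V_def E_def], unfolded kl(3), OF \<delta>(2)]
      unfolding d_def lower_def D_def \<pi>_def V_def .
    \<comment> \<open>A real supremum dominates its members only when they are bounded above, which
      the uniform upper bound ensures.\<close>
    have "bdd_above (d n ` prob_mass_functions (V n))" using up by (auto simp: bdd_above_def)
    then have "d n ?\<delta> \<le> (SUP \<xi>\<in>prob_mass_functions (V n). d n \<xi>)" using \<delta>(1) by (rule cSUP_upper[rotated])
    moreover have "(SUP \<xi>\<in>prob_mass_functions (V n). d n \<xi>) \<le> upper n"
      using \<delta>(1) up by (intro cSUP_least) auto
    ultimately show ?case using low by linarith
  qed
  have "upper \<longlonglongrightarrow> (1 + D_const b) * exp (- a) + 0"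
    unfolding upper_def by (intro tendsto_intros D lim_const_over_n)
  then have upper: "upper \<longlonglongrightarrow> (1 + D_const b) * exp (- a)" by simp
  have "(\<lambda>n. 18 * (ln (real n) + a) / real n) \<longlonglongrightarrow> 0" by real_asymp
  then have "lower \<longlonglongrightarrow> exp (- a) * ((1 + D_const b) - 0 - 0) - 0"
    unfolding lower_def by (intro tendsto_intros D lim_const_over_n)
  then have lower: "lower \<longlonglongrightarrow> (1 + D_const b) * exp (- a)" by (simp add: mult.commute)
  have "(\<lambda>n. SUP \<xi>\<in>prob_mass_functions (V n). d n \<xi>) \<longlonglongrightarrow> (1 + D_const b) * exp (- a)"
    by (rule tendsto_sandwich[OF _ _ lower upper]) (use sandwich in \<open>auto elim: eventually_mono\<close>)
  then show "(\<lambda>n. SUP \<xi>\<in>prob_mass_functions (V n).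
        prob_space.expectation (M n \<xi>) (\<lambda>\<omega>.
          (L2_norm (V n) (\<pi> n)
            (\<lambda>x. \<eta> n \<xi> (mixing_time (m n) (n - m n) a) \<omega> x / \<pi> n x - 1))\<^sup>2))
      \<longlonglongrightarrow> (1 + D_const b) * exp (- a)"
    unfolding d_def .
qed

end
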